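(* Let $P=\{x_1,\ldots,x_n\}$ be a finite poset and $K$ a field. For an integer $d\ge 2$ let $I_{\mathcal{M}_d(P)}$ denote the toric ideal of multichains of $P$ of length $d-1$ (defined in the context). Then the following conditions are equivalent: (i) the comparability graph $G_P$ of $P$ is chordal; (ii) $I_{\mathcal{M}_d(P)}$ is generated by quadratic binomials for some integer $d\ge 2$; (iii) $I_{\mathcal{M}_d(P)}$ has a quadratic Gröbner basis for some integer $d\ge 2$; (iv) $I_{\mathcal{M}_d(P)}$ is generated by quadratic binomials for all $d\ge 2$; (v) $I_{\mathcal{M}_d(P)}$ has a quadratic Gröbner basis for all $d\ge 2$.
   Context: For an integer $d\ge 2$, a multichain of $P$ of length $d-1$ is a sequence $C: x_{i_1}\le x_{i_2}\le\cdots\le x_{i_d}$ of elements of $P$ (repetitions allowed), regarded as a multiset $\{x_{i_1},\ldots,x_{i_d}\}$; to it one associates $\rho(C)=\mathbf{e}_{i_1}+\cdots+\mathbf{e}_{i_d}\in\mathbb{Z}^n$, where $\mathbf{e}_i$ is the $i$-th unit vector. Let $\mathcal{M}_d(P)=\{C_1,\ldots,C_m\}$ be the set of all multichains of $P$ of length $d-1$. Then $I_{\mathcal{M}_d(P)}\subset K[y_1,\ldots,y_m]$ is the toric ideal of the matrix $A=(\rho(C_1),\ldots,\rho(C_m))$, i.e. the ideal generated by all binomials $\prod_{b_i>0}y_i^{b_i}-\prod_{b_j<0}y_j^{-b_j}$ with $\mathbf{b}\in\mathbb{Z}^m$, $A\mathbf{b}=\mathbf{0}$. The comparability graph $G_P$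 is the graph on vertex set $P$ in which $x_i,x_j$ are adjacent iff $x_i<x_j$ or $x_j<x_i$. A graph is chordal if every induced cycle has length three. An ideal "has a quadratic Gröbner basis" if there is a monomial order with respect to which it has a Gröbner basis consisting of binomials of degree $2$. *)

theory Defs
  imports "HOL-Library.Poly_Mapping" "HOL-Library.Multiset"
begin

text \<open>
  A monomial is its exponent vector (finitely supported), written additively; a polynomial is a
  finitely supported family of coefficients, with the convolution product as multiplication.
  The ring \<open>K[y\<^sub>v : v \<in> V]\<close> is the subring \<open>polys V\<close>, where \<open>K\<close> is the type \<open>'k\<close>.
\<close>

type_synonym 'v monomial = "'v \<Rightarrow>\<^sub>0 nat"

type_synonym ('v, 'k) mpoly = "'v monomial \<Rightarrow>\<^sub>0 'k"

definition monomials :: "'v set \<Rightarrow> 'v monomial set" where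
  "monomials V = {u. Poly_Mapping.keys u \<subseteq> V}"

definition polys :: "'v set \<Rightarrow> ('v, 'k::field) mpoly set" where
  "polys V = {p. Poly_Mapping.keys p \<subseteq> monomials V}"

definition mono_poly :: "'v monomial \<Rightarrow> ('v, 'k::field) mpoly" where
  "mono_poly u = Poly_Mapping.single u 1"

definition var :: "'v \<Rightarrow> ('v, 'k::field) mpoly" where
  "var v = mono_poly (Poly_Mapping.single v 1)"

definition mono_degree :: "'v monomial \<Rightarrow> nat" where
  "mono_degree u = (\<Sum>v\<in>Poly_Mapping.keys u. Poly_Mapping.lookup u v)"

definition total_degree :: "('v, 'k::field) mpoly \<Rightarrow> nat" where
  "total_degree p = Max (insert 0 (mono_degree ` Poly_Mapping.keys p))"

definition ideal_generated :: "'v set \<Rightarrow> ('v, 'k::field) mpoly set \<Rightarrow> ('v, 'k) mpoly set" where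
  "ideal_generated V B =
     {\<Sum>f\<in>F. q f * f | F q. finite F \<and> F \<subseteq> B \<and> (\<forall>f\<in>F. q f \<in> polys V)}"

definition quadratic_binomial :: "('v, 'k::field) mpoly \<Rightarrow> bool" where
  "quadratic_binomial p \<longleftrightarrow>
     (\<exists>u w. u \<noteq> w \<and> p = mono_poly u - mono_poly w) \<and> total_degree p = 2"

definition generated_by_quadratic_binomials ::
    "'v set \<Rightarrow> ('v, 'k::field) mpoly set \<Rightarrow> bool" where
  "generated_by_quadratic_binomials V I \<longleftrightarrow>
     (\<exists>B \<subseteq> polys V. (\<forall>f\<in>B. quadratic_binomial f) \<and> I = ideal_generated V B)"

definition monomial_order :: "'v set \<Rightarrow> 'v monomial rel \<Rightarrow> bool" where
  "monomial_order V r \<longleftrightarrow>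
     linear_order_on (monomials V) r \<and>
     (\<forall>u\<in>monomials V. (0, u) \<in> r) \<and>
     (\<forall>u\<in>monomials V. \<forall>v\<in>monomials V. \<forall>w\<in>monomials V. (u, v) \<in> r \<longrightarrow> (u + w, v + w) \<in> r)"

text \<open>Meaningful only for nonzero polynomials.\<close>

definition initial_monomial :: "'v monomial rel \<Rightarrow> ('v, 'k::field) mpoly \<Rightarrow> 'v monomial" where
  "initial_monomial r f =
     (THE u. u \<in> Poly_Mapping.keys f \<and> (\<forall>w\<in>Poly_Mapping.keys f. (w, u) \<in> r))"

definition initial_ideal ::
    "'v set \<Rightarrow> 'v monomial rel \<Rightarrow> ('v, 'k::field) mpoly set \<Rightarrow> ('v, 'k) mpoly set" where
  "initial_ideal V r I = ideal_generated V ((\<lambda>f. mono_poly (initial_monomial r f)) ` (I - {0}))"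

definition groebner_basis ::
    "'v set \<Rightarrow> 'v monomial rel \<Rightarrow> ('v, 'k::field) mpoly set \<Rightarrow> ('v, 'k) mpoly set \<Rightarrow> bool" where
  "groebner_basis V r I G \<longleftrightarrow>
     finite G \<and> G \<subseteq> I - {0} \<and>
     initial_ideal V r I = ideal_generated V ((\<lambda>g. mono_poly (initial_monomial r g)) ` G)"

definition has_quadratic_groebner_basis ::
    "'v set \<Rightarrow> ('v, 'k::field) mpoly set \<Rightarrow> bool" where
  "has_quadratic_groebner_basis V I \<longleftrightarrow>
     (\<exists>r G. monomial_order V r \<and> groebner_basis V r I G \<and> (\<forall>g\<in>G. quadratic_binomial g))"

text \<open>
  The integer matrix has rows indexed by \<open>R\<close> and columns \<open>a v\<close> indexed by \<open>v \<in> V\<close>; only the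
  values on \<open>V\<close> of an integer vector \<open>b\<close> matter.
\<close>

definition toric_binomial :: "'v set \<Rightarrow> ('v \<Rightarrow> int) \<Rightarrow> ('v, 'k::field) mpoly" where
  "toric_binomial V b =
     (\<Prod>v\<in>{v\<in>V. b v > 0}. var v ^ nat (b v)) - (\<Prod>v\<in>{v\<in>V. b v < 0}. var v ^ nat (- b v))"

definition toric_ideal ::
    "'i set \<Rightarrow> 'v set \<Rightarrow> ('v \<Rightarrow> 'i \<Rightarrow> int) \<Rightarrow> ('v, 'k::field) mpoly set" where
  "toric_ideal R V a =
     ideal_generated V {toric_binomial V b | b. \<forall>i\<in>R. (\<Sum>v\<in>V. a v i * b v) = 0}"

text \<open>A finite poset is a finite subset of a partially ordered type with the induced order.\<close>

definition multichains :: "nat \<Rightarrow> 'a::order set \<Rightarrow> 'a multiset set" where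
  "multichains d P = {mset xs | xs. length xs = d \<and> set xs \<subseteq> P \<and> sorted_wrt (\<le>) xs}"

definition rho :: "'a multiset \<Rightarrow> 'a \<Rightarrow> int" where
  "rho C i = (\<Sum>x\<in>#C. of_bool (i = x))"

definition multichain_ideal :: "nat \<Rightarrow> 'a::order set \<Rightarrow> ('a multiset, 'k::field) mpoly set" where
  "multichain_ideal d P = toric_ideal P (multichains d P) rho"

definition comparability_edges :: "'a::order set \<Rightarrow> 'a set set" where
  "comparability_edges P = {{x, y} | x y. x \<in> P \<and> y \<in> P \<and> (x < y \<or> y < x)}"

text \<open>Graphs are given by a vertex set and a set of two-element edges.\<close>

definition induced_cycle :: "'a set \<Rightarrow> 'a set set \<Rightarrow> 'a list \<Rightarrow> bool" where
  "induced_cycle V E xs \<longleftrightarrow>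
     length xs \<ge> 3 \<and> distinct xs \<and> set xs \<subseteq> V \<and>
     (\<forall>i<length xs. \<forall>j<length xs.
        {xs ! i, xs ! j} \<in> E \<longleftrightarrow>
          j = Suc i mod length xs \<or> i = Suc j mod length xs)"

definition chordal :: "'a set \<Rightarrow> 'a set set \<Rightarrow> bool" where
  "chordal V E \<longleftrightarrow> (\<forall>xs. induced_cycle V E xs \<longrightarrow> length xs = 3)"

end

theory Submission
  imports Defs "HOL-Library.Multiset_Order"
begin

text \<open>
  The toric ideal is spanned by the binomials of pairs of monomials of equal multidegree, so its
  quadratic generation means that quadratic moves connect each fibre of the multidegree.

  If the comparability graph is not chordal, an induced cycle of length at least four alternates
  between going up and going down, hence is even, and it supports two distinct monomials of the
  same multidegree, one of which admits no quadratic move.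

  If the graph is chordal, then it is even strongly chordal (the 3-sun is no comparability graph):
  its vertices can be eliminated one by one such that the closed neighbourhoods of the neighbours
  of an eliminated vertex form a chain under inclusion. For two multichains, exchanging elements so
  that the multichain with the earlier vertices collects as many early vertices as possible gives
  quadratic binomials whose initial terms are taken with respect to a degree reverse lexicographic
  order. A monomial that admits no further exchange is determined by its multidegree: its first
  multichain consists of the earliest \<open>d\<close> vertices adjacent to the first vertex.
\<close>

section \<open>Strong elimination orderings\<close>

text \<open>An exchange moves a vertex into each of two multichains. That the vertex entering the
  multichain with the earlier vertices fits there is perfect elimination; that the vertex leaving it
  fits into the other multichain is where the nested neighbourhoods are needed. The 3-sun is
  excluded by transitivity: if its inner triangle is a < b < c, the tip adjacent to a and b must lie
  above b and the tip adjacent to b and c below b, which makes the two tips comparable. Simple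
  vertices are not derived from forbidden subgraphs; the order enters directly, for instance through
  \<open>common_upper\<close> and \<open>common_lower\<close>.

  Connectivity of fibres does not depend on the field: it is read off from the linear functional
  that adds up the coefficients of one class of monomials. The obstruction exists for each
  \<open>d\<close> \<ge> 2 separately, so a single \<open>d\<close> forces chordality, whereas one
  elimination ordering serves all \<open>d\<close> at once. Four-cycles need an obstruction of their
  own, since two opposite edges of a four-cycle can trade end points.\<close>

definition comparable :: "('a \<Rightarrow> 'a \<Rightarrow> bool) \<Rightarrow> 'a \<Rightarrow> 'a \<Rightarrow> bool" where
  "comparable le x y \<longleftrightarrow> le x y \<or> le y x"

definition nbhd :: "('a \<Rightarrow> 'a \<Rightarrow> bool) \<Rightarrow> 'a set \<Rightarrow> 'a \<Rightarrow> 'a set" where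
  "nbhd R S x = {y \<in> S. R x y}"

definition simple_vertex :: "('a \<Rightarrow> 'a \<Rightarrow> bool) \<Rightarrow> 'a set \<Rightarrow> 'a \<Rightarrow> bool" where
  "simple_vertex R S v \<longleftrightarrow> v \<in> S \<and>
     (\<forall>x\<in>nbhd R S v. \<forall>y\<in>nbhd R S v. nbhd R S x \<subseteq> nbhd R S y \<or> nbhd R S y \<subseteq> nbhd R S x)"

text \<open>Vertices are eliminated in decreasing order of \<open>h\<close>; the case \<open>j = k\<close> makes the elimination perfect.\<close>

definition strong_elimination :: "('a \<Rightarrow> 'a \<Rightarrow> bool) \<Rightarrow> 'a set \<Rightarrow> ('a \<Rightarrow> nat) \<Rightarrow> bool" where
  "strong_elimination R S h \<longleftrightarrow> inj_on h S \<and>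
     (\<forall>i\<in>S. \<forall>j\<in>S. \<forall>k\<in>S. \<forall>l\<in>S.
        h l < h k \<and> h k \<le> h j \<and> h j < h i \<and> R i k \<and> R i l \<and> R j k \<longrightarrow> R j l)"

text \<open>The induction needs an order that refines inclusion of closed neighbourhoods. Removing a vertex
  may make two neighbourhoods equal, so the tie-break \<open>t\<close> has to remember how they differed.\<close>

lemma strong_elimination_exists_aux:
  fixes R :: "'a \<Rightarrow> 'a \<Rightarrow> bool" and t :: "'a \<Rightarrow> nat"
  assumes "finite S"
    and refl: "\<And>x. R x x" and sym: "\<And>x y. R x y \<Longrightarrow> R y x"
    and simple: "\<And>T. T \<subseteq> S \<Longrightarrow> T \<noteq> {} \<Longrightarrow> \<exists>v. simple_vertex R T v"
  shows "\<exists>h. strong_elimination R S h \<and>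
     (\<forall>x\<in>S. \<forall>y\<in>S. nbhd R S x \<subset> nbhd R S y \<longrightarrow> h y < h x) \<and>
     (\<forall>x\<in>S. \<forall>y\<in>S. nbhd R S x = nbhd R S y \<and> t x < t y \<longrightarrow> h y < h x)"
  using assms(1) simple
proof (induction "card S" arbitrary: S t)
  case 0
  then show ?case by (simp add: strong_elimination_def)
next
  case (Suc n)
  let ?N = "nbhd R S"
  have "S \<noteq> {}" using Suc.hyps(2) by auto
  then obtain v0 where v0: "simple_vertex R S v0" using Suc.prems(2) by blast
  define A where "A = {v. simple_vertex R S v}"
  \<comment> \<open>\<open>v\<close> is to receive the greatest value, so nothing may be required to
    lie above it. A vertex \<open>x\<close> with \<open>?N x\<close> inside \<open>?N v\<close> is
    simple as well (\<open>inA\<close>), so the least neighbourhood size rules out a proper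
    inclusion and the least \<open>t\<close> rules out a tie with \<open>t x < t v\<close>.\<close>
  define m where "m = (LEAST m. \<exists>v\<in>A. card (?N v) = m)"
  obtain v1 where v1: "v1 \<in> A" "card (?N v1) = m"
    unfolding m_def using v0 LeastI_ex[of "\<lambda>m. \<exists>v\<in>A. card (?N v) = m"] by (auto simp: A_def)
  have m_le: "m \<le> card (?N v)" if "v \<in> A" for v
    unfolding m_def using that by (auto intro!: Least_le)
  define m' where "m' = (LEAST k. \<exists>v\<in>A. card (?N v) = m \<and> t v = k)"
  obtain v where v: "v \<in> A" "card (?N v) = m" "t v = m'"
    unfolding m'_def using v1 LeastI_ex[of "\<lambda>k. \<exists>v\<in>A. card (?N v) = m \<and> t v = k"] by auto
  have m'_le: "m' \<le> t w" if "w \<in> A" "card (?N w) = m" for w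
    unfolding m'_def using that by (auto intro!: Least_le)
  have vS: "v \<in> S" and simp_v: "\<And>x y. x \<in> ?N v \<Longrightarrow> y \<in> ?N v \<Longrightarrow> ?N x \<subseteq> ?N y \<or> ?N y \<subseteq> ?N x"
    using v(1) by (auto simp: A_def simple_vertex_def)
  have finN: "finite (?N x)" for x using Suc.prems(1) by (simp add: nbhd_def)
  have inA: "x \<in> A" if "x \<in> S" "?N x \<subseteq> ?N v" for x
    using that simp_v by (auto simp: A_def simple_vertex_def)
  define S' where "S' = S - {v}"
  \<comment> \<open>\<open>M\<close> exceeds every value of \<open>t\<close>, so that in
    \<open>t'\<close> adjacency to the deleted vertex \<open>v\<close> takes precedence over
    \<open>t\<close>.\<close>
  define M where "M = Suc (Max (t ` S))"
  have tM: "t x < M" if "x \<in> S" for x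
    unfolding M_def using that Suc.prems(1) by (simp add: le_imp_less_Suc)
  define t' where "t' x = (if R v x then t x + M else t x)" for x
  have "card S' = n" "finite S'" using Suc.hyps(2) Suc.prems(1) vS by (auto simp: S'_def)
  moreover have "\<exists>v. simple_vertex R T v" if "T \<subseteq> S'" "T \<noteq> {}" for T
    using Suc.prems(2)[of T] that by (auto simp: S'_def)
  ultimately have "\<exists>h. strong_elimination R S' h \<and>
     (\<forall>x\<in>S'. \<forall>y\<in>S'. nbhd R S' x \<subset> nbhd R S' y \<longrightarrow> h y < h x) \<and>
     (\<forall>x\<in>S'. \<forall>y\<in>S'. nbhd R S' x = nbhd R S' y \<and> t' x < t' y \<longrightarrow> h y < h x)"
    using Suc.hyps(1)[of S' t'] by blast
  then obtain h where h: "strong_elimination R S' h"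
    and h_sub: "\<And>x y. x \<in> S' \<Longrightarrow> y \<in> S' \<Longrightarrow> nbhd R S' x \<subset> nbhd R S' y \<Longrightarrow> h y < h x"
    and h_eq: "\<And>x y. x \<in> S' \<Longrightarrow> y \<in> S' \<Longrightarrow> nbhd R S' x = nbhd R S' y \<Longrightarrow> t' x < t' y \<Longrightarrow> h y < h x"
    by blast
  define g where "g = h(v := Suc (Max (insert 0 (h ` S'))))"
  have g_v: "h x < g v" if "x \<in> S'" for x
    using that \<open>finite S'\<close> unfolding g_def by (simp add: le_imp_less_Suc)
  have g_S': "g x = h x" if "x \<in> S'" for x using that by (auto simp: g_def S'_def)
  have g_lt_v: "g x < g v" if "x \<in> S" "x \<noteq> v" for x
    using that g_v[of x] g_S'[of x] by (simp add: S'_def)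
  have sub: "g y < g x" if xy: "x \<in> S" "y \<in> S" "?N x \<subset> ?N y" for x y
  proof (cases "y = v")
    case True
    then have "x \<in> A" using inA xy by blast
    moreover have "card (?N x) < m" using xy True finN v(2) psubset_card_mono by metis
    ultimately show ?thesis using m_le[of x] by simp
  next
    case False
    show ?thesis
    proof (cases "x = v")
      case True
      then show ?thesis using g_lt_v xy False by blast
    next
      case x: False
      have xy': "x \<in> S'" "y \<in> S'" using xy x False by (auto simp: S'_def)
      have le: "nbhd R S' x \<subseteq> nbhd R S' y" using xy(3) by (auto simp: nbhd_def S'_def)
      show ?thesis
      proof (cases "nbhd R S' x = nbhd R S' y")
        case True
        then have "R y v" "\<not> R x v" using xy(3) by (auto simp: nbhd_def S'_def)
        then have "R v y" "\<not> R v x" using sym by blast+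
        then have "t' x < t' y" using tM[OF xy(1)] by (simp add: t'_def)
        then show ?thesis using h_eq[OF xy' True] xy' by (simp add: g_S')
      next
        case False
        then show ?thesis using h_sub[OF xy'] le xy' by (auto simp: g_S')
      qed
    qed
  qed
  have eq: "g y < g x" if xy: "x \<in> S" "y \<in> S" "?N x = ?N y" "t x < t y" for x y
  proof (cases "y = v")
    case True
    then have "x \<in> A" using inA xy by blast
    then have "m' \<le> t x" using m'_le xy(3) True v(2) by simp
    then show ?thesis using xy(4) True v(3) by simp
  next
    case False
    show ?thesis
    proof (cases "x = v")
      case True
      then show ?thesis using g_lt_v xy False by blast
    next
      case x: False
      have xy': "x \<in> S'" "y \<in> S'" using xy x False by (auto simp: S'_def)
      have e: "nbhd R S' x = nbhd R S' y" using xy(3) by (auto simp: nbhd_def S'_def)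
      have "R x v \<longleftrightarrow> R y v" using xy(3) vS by (auto simp: nbhd_def)
      then have "R v x \<longleftrightarrow> R v y" using sym by blast
      then have "t' x < t' y" using xy(4) by (simp add: t'_def)
      then show ?thesis using h_eq[OF xy' e] xy' by (simp add: g_S')
    qed
  qed
  have "strong_elimination R S g"
    unfolding strong_elimination_def
  proof (intro conjI ballI impI)
    have "inj_on h S'" using h by (simp add: strong_elimination_def)
    then have "inj_on g S'" using g_S' by (simp cong: inj_on_cong)
    moreover have S: "S = insert v S'" using vS by (auto simp: S'_def)
    moreover have "g v \<notin> g ` (S' - {v})" using g_v g_S' by fastforce
    ultimately show "inj_on g S" by (subst S, subst inj_on_insert) blast
  next
    fix i j k l assume S: "i \<in> S" "j \<in> S" "k \<in> S" "l \<in> S"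
      and *: "g l < g k \<and> g k \<le> g j \<and> g j < g i \<and> R i k \<and> R i l \<and> R j k"
    have nv: "j \<noteq> v" "k \<noteq> v" "l \<noteq> v"
      using * g_lt_v[of i] S by (cases "i = v"; force)+
    then have S': "j \<in> S'" "k \<in> S'" "l \<in> S'" using S by (auto simp: S'_def)
    show "R j l"
    proof (cases "i = v")
      case True
      then have "k \<in> ?N v" "l \<in> ?N v" using * S by (auto simp: nbhd_def)
      \<comment> \<open>As \<open>v\<close> is simple, the neighbourhoods of \<open>k\<close> and
        \<open>l\<close> are nested; \<open>g l < g k\<close> and \<open>sub\<close> leave only the
        inclusion that yields \<open>R j l\<close>.\<close>
      then have "?N k \<subseteq> ?N l \<or> ?N l \<subset> ?N k" using simp_v by blast
      moreover have "\<not> ?N l \<subset> ?N k" using sub[of l k] S * by auto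
      ultimately have "j \<in> ?N l" using * S sym by (auto simp: nbhd_def)
      then show ?thesis using sym by (auto simp: nbhd_def)
    next
      case False
      then have "i \<in> S'" using S by (auto simp: S'_def)
      then show ?thesis using h S' * unfolding strong_elimination_def by (metis g_S')
    qed
  qed
  then show ?case using sub eq by blast
qed

lemma strong_elimination_exists:
  assumes "finite S" "\<And>x. R x x" "\<And>x y. R x y \<Longrightarrow> R y x"
    and "\<And>T. T \<subseteq> S \<Longrightarrow> T \<noteq> {} \<Longrightarrow> \<exists>v. simple_vertex R T v"
  shows "\<exists>h. strong_elimination R S h"
  using strong_elimination_exists_aux[where R = R and t = "\<lambda>_. 0", OF assms] by blast

section \<open>Bad edges and simple vertices in chordal comparability graphs\<close>

text \<open>A vertex is simple unless its closed neighbourhood contains a bad edge. In a chordal graph a bad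
  edge \<open>x y\<close> separates its two sides, and a smallest side contains a simple vertex.\<close>

definition bad_edge :: "('a \<Rightarrow> 'a \<Rightarrow> bool) \<Rightarrow> 'a set \<Rightarrow> 'a \<Rightarrow> 'a \<Rightarrow> bool" where
  "bad_edge R S x y \<longleftrightarrow> x \<in> S \<and> y \<in> S \<and> R x y \<and>
     \<not> nbhd R S x \<subseteq> nbhd R S y \<and> \<not> nbhd R S y \<subseteq> nbhd R S x"

definition outside_step :: "('a \<Rightarrow> 'a \<Rightarrow> bool) \<Rightarrow> 'a set \<Rightarrow> 'a \<Rightarrow> 'a \<Rightarrow> 'a rel" where
  "outside_step R S x y = {(p, q). p \<in> S - (nbhd R S x \<inter> nbhd R S y) \<and>
     q \<in> S - (nbhd R S x \<inter> nbhd R S y) \<and> R p q}"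

text \<open>The second argument names the side: for an edge \<open>x y\<close>, both ends of which
  are deleted, these are the components that contain private neighbours of \<open>y\<close>.\<close>

definition side :: "('a \<Rightarrow> 'a \<Rightarrow> bool) \<Rightarrow> 'a set \<Rightarrow> 'a \<Rightarrow> 'a \<Rightarrow> 'a set" where
  "side R S x y = (outside_step R S x y)\<^sup>* `` (nbhd R S y - nbhd R S x)"

text \<open>The order is a parameter, so that \<open>dual\<close> can reverse it, and
  \<open>S\<close> varies because every nonempty subset must have a simple vertex. Chordality enters
  only through \<open>no_C4\<close> and \<open>sep\<close>; a violation of \<open>sep\<close> is a
  walk around an edge, which would close up to an induced cycle.\<close>

locale chordal_poset =
  fixes le :: "'a \<Rightarrow> 'a \<Rightarrow> bool" and S :: "'a set"
  assumes fin: "finite S"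
    and refl: "le x x"
    and antisym: "le x y \<Longrightarrow> le y x \<Longrightarrow> x = y"
    and trans: "le x y \<Longrightarrow> le y z \<Longrightarrow> le x z"
    and no_C4: "a \<in> S \<Longrightarrow> b \<in> S \<Longrightarrow> c \<in> S \<Longrightarrow> d \<in> S \<Longrightarrow>
      comparable le a b \<Longrightarrow> comparable le b c \<Longrightarrow> comparable le c d \<Longrightarrow> comparable le d a \<Longrightarrow>
      comparable le a c \<or> comparable le b d"
    and sep: "x \<in> S \<Longrightarrow> y \<in> S \<Longrightarrow> comparable le x y \<Longrightarrow>
      p \<in> nbhd (comparable le) S y - nbhd (comparable le) S x \<Longrightarrow>
      q \<in> nbhd (comparable le) S x - nbhd (comparable le) S y \<Longrightarrow>
      (p, q) \<notin> (outside_step (comparable le) S x y)\<^sup>*"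
begin

abbreviation "R \<equiv> comparable le"
abbreviation "N \<equiv> nbhd R S"
abbreviation "bad \<equiv> bad_edge R S"
abbreviation "sd \<equiv> side R S"

lemma R_refl: "R x x" by (simp add: comparable_def refl)
lemma R_sym: "R x y \<Longrightarrow> R y x" by (auto simp: comparable_def)
lemma R_ge: "le y x \<Longrightarrow> R x y" by (simp add: comparable_def)

lemma bad_sym: "bad x y \<Longrightarrow> bad y x"
  unfolding bad_edge_def using R_sym by blast

text \<open>A neighbour of \<open>x\<close> below \<open>x\<close> would lie below \<open>y\<close>
  as well; so private neighbours of the lower end lie above it, and dually those of the upper end
  lie below it.\<close>

lemma bad_witness:
  assumes "bad x y" "le x y"
  obtains z w where "z \<in> S" "le x z" "\<not> R y z" "w \<in> S" "le w y" "\<not> R x w"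
proof -
  obtain z w where zw: "z \<in> S" "R x z" "\<not> R y z" "w \<in> S" "R y w" "\<not> R x w"
    using assms(1) unfolding bad_edge_def nbhd_def by auto
  moreover have "le x z" "le w y"
    using zw assms(2) trans unfolding comparable_def by blast+
  ultimately show thesis using that by blast
qed

text \<open>With a private neighbour \<open>z\<close> of \<open>x\<close> above \<open>x\<close>,
  the vertices \<open>a\<close>, \<open>y\<close>, \<open>b\<close>, \<open>z\<close> form a
  four-cycle whose chord \<open>y z\<close> is missing, so \<open>a b\<close> is a chord.\<close>

lemma common_upper:
  assumes "bad x y" "le x y" "le a x" "le b x" "a \<in> S" "b \<in> S"
  shows "R a b"
proof -
  obtain z where z: "z \<in> S" "le x z" "\<not> R y z" using bad_witness[OF assms(1,2)] by metis
  have "y \<in> S" using assms(1) by (simp add: bad_edge_def)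
  moreover have "R a y" "R y b" "R b z" "R z a"
    using z assms trans unfolding comparable_def by blast+
  ultimately show ?thesis using no_C4[of a y b z] z assms by blast
qed

lemma common_lower:
  assumes "bad x y" "le x y" "le y a" "le y b" "a \<in> S" "b \<in> S"
  shows "R a b"
proof -
  obtain z where z: "z \<in> S" "le z y" "\<not> R x z" using bad_witness[OF assms(1,2)] by metis
  have "x \<in> S" using assms(1) by (simp add: bad_edge_def)
  moreover have "R a x" "R x b" "R b z" "R z a"
    using z assms trans unfolding comparable_def by blast+
  ultimately show ?thesis using no_C4[of a x b z] z assms by blast
qed

lemma side_start: "p \<in> N y \<Longrightarrow> p \<notin> N x \<Longrightarrow> p \<in> sd x y"
  unfolding side_def by blast

lemma side_outside: 
  assumes "q \<in> sd x y" shows "q \<in> S" "q \<notin> N x \<inter> N y"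
proof -
  obtain p where p: "p \<in> N y - N x" "(p, q) \<in> (outside_step R S x y)\<^sup>*"
    using assms unfolding side_def by blast
  from p(2) have "q \<in> S - (N x \<inter> N y)"
    by (cases rule: rtranclE) (use p in \<open>auto simp: outside_step_def nbhd_def\<close>)
  then show "q \<in> S" "q \<notin> N x \<inter> N y" by auto
qed

lemma side_closed:
  assumes "q \<in> sd x y" "R q q'" "q' \<in> S" "q' \<notin> N x \<inter> N y"
  shows "q' \<in> sd x y"
proof -
  obtain p where p: "p \<in> N y - N x" "(p, q) \<in> (outside_step R S x y)\<^sup>*"
    using assms unfolding side_def by blast
  moreover have "(q, q') \<in> outside_step R S x y"
    using assms side_outside[OF assms(1)] by (simp add: outside_step_def)
  ultimately have "(p, q') \<in> (outside_step R S x y)\<^sup>*" by simp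
  then show ?thesis using p unfolding side_def by blast
qed

lemma side_not_adjacent:
  assumes "bad x y" "q \<in> sd x y" shows "q \<notin> N x"
proof
  assume "q \<in> N x"
  then have "q \<in> N x - N y" using side_outside[OF assms(2)] by blast
  then show False using sep[of x y _ q] assms unfolding side_def bad_edge_def by blast
qed

lemma side_disjoint:
  assumes "bad x y" "q \<in> sd x y" "q \<in> sd y x" shows False
proof -
  obtain p p' where p: "p \<in> N y - N x" "(p, q) \<in> (outside_step R S x y)\<^sup>*"
    and p': "p' \<in> N x - N y" "(p', q) \<in> (outside_step R S y x)\<^sup>*"
    using assms unfolding side_def by blast
  have "sym (outside_step R S x y)" "outside_step R S y x = outside_step R S x y"
    unfolding sym_def outside_step_def using R_sym by blast+
  then have "(q, p') \<in> (outside_step R S x y)\<^sup>*"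
    using p'(2) by (metis sym_rtrancl symD)
  then have "(p, p') \<in> (outside_step R S x y)\<^sup>*" using p(2) by simp
  then show False using sep[of x y p p'] p p' assms(1) unfolding bad_edge_def by blast
qed

lemma side_subset:
  assumes start: "N b - N a \<subseteq> sd x y" and avoid: "sd a b \<inter> (N x \<inter> N y) = {}"
  shows "sd a b \<subseteq> sd x y"
proof
  fix q assume "q \<in> sd a b"
  then obtain p where p: "p \<in> N b - N a" "(p, q) \<in> (outside_step R S a b)\<^sup>*"
    unfolding side_def by blast
  from p(2) show "q \<in> sd x y"
  proof (induction rule: rtrancl_induct)
    case base
    then show ?case using p start by blast
  next
    case (step q q')
    have "q' \<in> sd a b" using p(1) step.hyps unfolding side_def by (auto intro: rtrancl.rtrancl_into_rtrancl)
    then show ?case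
      using step side_closed[of q x y q'] avoid by (auto simp: outside_step_def)
  qed
qed

text \<open>Since \<open>b\<close> is not adjacent to \<open>x\<close>, the vertex \<open>x\<close>
  survives the deletion for \<open>a b\<close>. A vertex of \<open>sd a b\<close> adjacent to
  \<open>x\<close> would therefore pull \<open>x\<close> into \<open>sd a b\<close>, so
  \<open>sd a b\<close> avoids the neighbours of \<open>x\<close>.\<close>

lemma side_subset_adjacent:
  assumes "bad x y" "b \<in> sd x y" "x \<notin> sd a b"
  shows "sd a b \<subseteq> sd x y"
proof -
  have xS: "x \<in> S" using assms(1) by (simp add: bad_edge_def)
  have "b \<notin> N x" "b \<in> S" using side_not_adjacent side_outside assms by blast+
  then have "x \<notin> N b" using R_sym by (auto simp: nbhd_def)
  then have avoid: "sd a b \<inter> (N x \<inter> N y) = {}"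
    using side_closed[of _ a b x] assms(3) xS R_sym by (fastforce simp: nbhd_def)
  have "p \<in> sd x y" if "p \<in> N b - N a" for p
  proof -
    have "p \<in> sd a b" using that side_start by blast
    then have "p \<notin> N x \<inter> N y" using avoid by blast
    then show ?thesis using side_closed[OF assms(2), of p] that by (auto simp: nbhd_def)
  qed
  then show ?thesis using side_subset avoid by blast
qed

text \<open>Every neighbour of \<open>x\<close> is one of \<open>a\<close>: above \<open>x\<close>
  by transitivity, below \<open>x\<close> by \<open>common_upper\<close>. So \<open>sd a b\<close>,
  which avoids the neighbours of \<open>a\<close>, avoids those of \<open>x\<close>; and it starts
  from vertices below \<open>b\<close>, hence below \<open>y\<close>.\<close>

lemma side_subset_interleaved:
  assumes xy: "bad x y" "le x y" and ab: "bad a b" "le a b"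
    and le: "le a x" "le x b" "le b y"
  shows "sd a b \<subseteq> sd x y"
proof (rule side_subset)
  have S: "a \<in> S" "x \<in> S" using xy ab by (auto simp: bad_edge_def)
  have not_adj: "\<not> R x p" if "p \<in> S" "\<not> R a p" for p
    using that S common_upper[OF xy, of a p] le trans unfolding comparable_def by blast
  show "N b - N a \<subseteq> sd x y"
  proof
    fix p assume p: "p \<in> N b - N a"
    then have "le p b" using ab trans unfolding nbhd_def comparable_def by blast
    then have "R y p" using le trans R_ge by blast
    then show "p \<in> sd x y" using p not_adj side_start[of p y x] by (auto simp: nbhd_def)
  qed
  have "\<not> R x s" if "s \<in> sd a b" for s
    using not_adj side_not_adjacent[OF ab(1) that] side_outside[OF that] by (auto simp: nbhd_def)
  then show "sd a b \<inter> (N x \<inter> N y) = {}" by (auto simp: nbhd_def)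
qed

text \<open>Only bad edges spanning maximal intervals may be compared by the size of their sides: a vertex
  \<open>v\<close> with \<open>a < x, v < y < b\<close> can be a whole side of \<open>x y\<close> although \<open>a b\<close> is bad.\<close>

definition outer :: "'a \<Rightarrow> 'a \<Rightarrow> bool" where
  "outer x y \<longleftrightarrow> bad x y \<and> le x y \<and> (\<forall>a b. bad a b \<and> le a x \<and> le y b \<longrightarrow> a = x \<and> b = y)"

lemma outer_exists:
  assumes "bad a b" "le a b"
  shows "\<exists>a' b'. outer a' b' \<and> le a' a \<and> le b b'"
  using assms
proof (induction "card S - card {c \<in> S. le a c \<and> le c b}" arbitrary: a b rule: less_induct)
  case less
  let ?I = "\<lambda>a b. {c \<in> S. le a c \<and> le c b}"
  show ?case
  proof (cases "outer a b")
    case True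
    then show ?thesis using refl by blast
  next
    case False
    then obtain a' b' where *: "bad a' b'" "le a' a" "le b b'" "\<not> (a' = a \<and> b' = b)"
      using less.prems unfolding outer_def by blast
    have ab': "le a' b'" "le a b'" "le a' b" using * less.prems trans by blast+
    have S: "a' \<in> S" "b' \<in> S" using * by (auto simp: bad_edge_def)
    have "?I a b \<subseteq> ?I a' b'" using * trans by blast
    moreover have "a' \<in> ?I a' b'" "b' \<in> ?I a' b'" using S ab' refl by auto
    moreover have "a' \<notin> ?I a b \<or> b' \<notin> ?I a b" using * antisym by blast
    ultimately have "?I a b \<subset> ?I a' b'" by blast
    then have "card (?I a b) < card (?I a' b')" using fin by (intro psubset_card_mono) auto
    moreover have "card (?I a' b') \<le> card S" using fin by (intro card_mono) auto
    ultimately obtain a'' b'' where "outer a'' b''" "le a'' a'" "le b' b''"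
      using less.hyps[of a' b'] * ab' by (auto simp: diff_less_mono2)
    then show ?thesis using * trans by blast
  qed
qed

text \<open>Widening a bad edge loses no common neighbour: if \<open>v\<close> lies above the old
  lower end it lies above the new one, and if it lies below, \<open>common_upper\<close> applies;
  dually at the upper end.\<close>

lemma outer_exists_adjacent:
  assumes ab: "bad a b" and v: "v \<in> S" "R v a" "R v b"
  shows "\<exists>a b. outer a b \<and> R v a \<and> R v b"
proof -
  have "\<exists>a b. outer a b \<and> R v a \<and> R v b"
    if ab: "bad a b" "le a b" and v: "R v a" "R v b" for a b
  proof -
    obtain a' b' where *: "outer a' b'" "le a' a" "le b b'" using outer_exists ab by blast
    have S: "a' \<in> S" "b' \<in> S" using * by (auto simp: outer_def bad_edge_def)
    have "R v a'"
      using v(1) common_upper[OF ab, of v a'] *(2) S \<open>v \<in> S\<close> trans R_ge unfolding comparable_def by blast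
    moreover have "R v b'"
      using v(2) common_lower[OF ab, of v b'] *(3) S \<open>v \<in> S\<close> trans R_ge unfolding comparable_def by blast
    ultimately show ?thesis using * by blast
  qed
  moreover have "le a b \<or> le b a" using ab by (simp add: bad_edge_def comparable_def)
  ultimately show ?thesis using ab v bad_sym by blast
qed

lemma dual: "chordal_poset (\<lambda>x y. le y x) S"
proof -
  have "comparable (\<lambda>x y. le y x) = R" by (intro ext) (auto simp: comparable_def)
  then show ?thesis
    by unfold_locales (use fin refl antisym trans no_C4 sep in \<open>auto\<close>)
qed

text \<open>In a smallest side of an outer bad edge, take a vertex \<open>v\<close> with the fewest
  neighbours. If a bad edge lay in its neighbourhood, an outer one would, and one of its sides would
  be a proper subset of the smallest side.\<close>

lemma simple_vertex_exists:
  assumes "S \<noteq> {}" shows "\<exists>v. simple_vertex R S v"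
proof -
  have simple_min: "simple_vertex R S v"
    if v: "v \<in> S" and no_bad: "\<And>a b. bad a b \<Longrightarrow> R v a \<Longrightarrow> R v b \<Longrightarrow> False"
      and min: "\<And>u. u \<in> N v \<Longrightarrow> \<not> N u \<subset> N v" for v
  proof -
    \<comment> \<open>\<open>v\<close> is its own neighbour, so the edge \<open>v u\<close> is not
      bad either, and minimality decides the inclusion. Thus the neighbourhood of \<open>v\<close>
      is a clique without bad edges.\<close>
    have "N v \<subseteq> N u" if u: "u \<in> N v" for u
      using no_bad[of v u] min[OF u] u v R_refl unfolding bad_edge_def nbhd_def by blast
    then have "R a b" if "a \<in> N v" "b \<in> N v" for a b
      using that unfolding nbhd_def by blast
    then show ?thesis
      using no_bad v unfolding simple_vertex_def bad_edge_def nbhd_def by blast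
  qed
  show ?thesis
  proof (cases "\<exists>a b. bad a b")
    case False
    obtain v where v: "v \<in> S" "\<And>u. u \<in> S \<Longrightarrow> card (N v) \<le> card (N u)"
      using assms ex_has_least_nat[of "\<lambda>v. v \<in> S" _ "\<lambda>v. card (N v)"] by blast
    have "\<not> N u \<subset> N v" if "u \<in> N v" for u
      using v(2)[of u] that fin psubset_card_mono[of "N v" "N u"] by (auto simp: nbhd_def)
    then show ?thesis using simple_min v False by blast
  next
    case True
    from True obtain a b where ab: "bad a b" by blast
    \<comment> \<open>Pairs are taken in both directions so that both sides of each outer edge
      compete for the least size.\<close>
    define ob where "ob = (\<lambda>(x, y). outer x y \<or> outer y x)"
    have "le a b \<or> le b a" using ab by (simp add: bad_edge_def comparable_def)
    then have "\<exists>x y. outer x y" using ab outer_exists bad_sym by blast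
    then have "\<exists>e. ob e" by (auto simp: ob_def)
    then obtain e where e: "ob e" "\<And>e'. ob e' \<Longrightarrow> card (sd (fst e) (snd e)) \<le> card (sd (fst e') (snd e'))"
      using ex_has_least_nat[of ob _ "\<lambda>e. card (sd (fst e) (snd e))"] by blast
    obtain x y where [simp]: "e = (x, y)" by force
    let ?Y = "sd x y"
    have finY: "finite ?Y" using side_outside(1) fin by (meson finite_subset subsetI)
    have xy: "outer x y \<or> outer y x" using e(1) by (simp add: ob_def)
    then have bad: "bad x y" using bad_sym by (auto simp: outer_def)
    have min: "\<not> sd a b \<subset> ?Y" if "outer a b \<or> outer b a" for a b
      using e(2)[of "(a, b)"] that psubset_card_mono[OF finY, of "sd a b"] by (auto simp: ob_def)
    have "?Y \<noteq> {}" using bad side_start unfolding bad_edge_def by blast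
    then obtain v where v: "v \<in> ?Y" "\<And>u. u \<in> ?Y \<Longrightarrow> card (N v) \<le> card (N u)"
      using ex_has_least_nat[of "\<lambda>v. v \<in> ?Y" _ "\<lambda>v. card (N v)"] by blast
    have vS: "v \<in> S" and vx: "v \<notin> N x" using v(1) side_outside side_not_adjacent bad by blast+
    then have vx: "\<not> R v x" using R_sym by (auto simp: nbhd_def)
    have S: "x \<in> S" "y \<in> S" using bad by (auto simp: bad_edge_def)
    \<comment> \<open>\<open>v\<close> is minimal only within \<open>?Y\<close>; but
      \<open>x\<close> is not adjacent to \<open>v\<close>, hence not to such a \<open>u\<close>,
      and this keeps \<open>u\<close> in \<open>?Y\<close>.\<close>
    have "\<not> N u \<subset> N v" if u: "u \<in> N v" for u
    proof
      assume less: "N u \<subset> N v"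
      have "R v u" "u \<in> S" using u by (auto simp: nbhd_def)
      have "u \<notin> N x" 
      proof
        assume "u \<in> N x"
        then have "x \<in> N u" using R_sym S by (auto simp: nbhd_def)
        then show False using less vx by (auto simp: nbhd_def)
      qed
      then have "u \<in> ?Y" using side_closed v(1) \<open>R v u\<close> \<open>u \<in> S\<close> by blast
      then show False using v(2)[of u] less fin psubset_card_mono[of "N v" "N u"]
        by (auto simp: nbhd_def)
    qed
    moreover have False if "bad a b" "R v a" "R v b" for a b
    proof -
      obtain a b where ab: "outer a b" and va: "R v a" and vb: "R v b"
        using outer_exists_adjacent \<open>bad a b\<close> \<open>R v a\<close> \<open>R v b\<close> vS by blast
      have bad_ab: "bad a b" "le a b" using ab by (auto simp: outer_def)
      have abS: "a \<in> S" "b \<in> S" using bad_ab by (auto simp: bad_edge_def)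
      \<comment> \<open>\<open>v\<close> lies in \<open>?Y\<close>, but as a common neighbour of
        \<open>a\<close> and \<open>b\<close> in neither of their sides; so the inclusion would be
        proper, against minimality.\<close>
      have contra: False if "sd a b \<subseteq> ?Y \<or> sd b a \<subseteq> ?Y"
      proof -
        have "v \<in> N a" "v \<in> N b" using va vb vS R_sym by (auto simp: nbhd_def)
        then have "v \<notin> sd a b" "v \<notin> sd b a" using side_outside by blast+
        then show False using that v(1) min ab by blast
      qed
      have in_Y: "p \<in> ?Y \<or> R x p \<and> R y p" if "R v p" "p \<in> S" for p
        using side_closed[OF v(1) that] by (auto simp: nbhd_def)
      have Y_x: "\<not> R p x" if "p \<in> ?Y" for p
        using side_not_adjacent[OF bad that] side_outside(1)[OF that] R_sym by (auto simp: nbhd_def)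
      have start: "x \<in> sd a b" if "R x b" "\<not> R a x" for a b
        using side_start[of x b a] that S R_sym by (auto simp: nbhd_def)
      consider "a \<in> ?Y" "b \<in> ?Y" | "a \<in> ?Y" "R x b" | "b \<in> ?Y" "R x a"
        | "R x a" "R x b" "R y a" "R y b"
        using in_Y va vb abS by blast
      then show False
      proof cases
        \<comment> \<open>By disjointness \<open>x\<close> lies outside one of the two sides of
          \<open>a b\<close>, and that side is contained in \<open>?Y\<close>. In the next two cases
          it is known which one.\<close>
        case 1
        then show False
          using side_disjoint[OF bad_ab(1)] side_subset_adjacent[OF bad] contra by blast
      next
        case 2
        then have "x \<in> sd a b" using start Y_x by blast
        then have "x \<notin> sd b a" using side_disjoint[OF bad_ab(1)] by blast
        then show False using side_subset_adjacent[OF bad] 2 contra by blast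
      next
        case 3
        then have "x \<in> sd b a" using start Y_x by blast
        then have "x \<notin> sd a b" using side_disjoint[OF bad_ab(1)] by blast
        then show False using side_subset_adjacent[OF bad] 3 contra by blast
      next
        case 4
        \<comment> \<open>\<open>v\<close> and \<open>x\<close> are incomparable common neighbours
          of \<open>a\<close> and \<open>b\<close>. Both above \<open>b\<close> or both below
          \<open>a\<close> contradicts \<open>common_lower\<close> or \<open>common_upper\<close>,
          and any other position outside the interval makes them comparable by transitivity.\<close>
        have "\<not> (le b x \<and> le b v)" "\<not> (le x a \<and> le v a)"
          using common_lower[OF bad_ab, of v x] common_upper[OF bad_ab, of v x] vx vS S by blast+
        then have between: "le a x" "le x b" "le a v" "le v b"
          using 4 va vb vx bad_ab(2) trans unfolding comparable_def by blast+
        have ne: "a \<noteq> x" "b \<noteq> x" using va vb vx by auto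
        from xy show False
        proof
          assume o: "outer x y"
          \<comment> \<open>Otherwise \<open>a b\<close> would span a larger interval than the outer
            edge \<open>x y\<close>. So the two intervals interleave.\<close>
          then have "\<not> le y b" using bad_ab between ne unfolding outer_def by blast
          then have "le b y" using 4 by (auto simp: comparable_def)
          then show False
            using side_subset_interleaved[OF bad _ bad_ab] between o contra by (auto simp: outer_def)
        next
          assume o: "outer y x"
          then have "\<not> le a y" using bad_ab between ne unfolding outer_def by blast
          then have ya: "le y a" using 4 by (auto simp: comparable_def)
          interpret d: chordal_poset "\<lambda>x y. le y x" S by (rule dual)
          have eq: "comparable (\<lambda>x y. le y x) = R" by (intro ext) (auto simp: comparable_def)
          have "sd b a \<subseteq> ?Y"
            using d.side_subset_interleaved[of x y b a] bad o bad_sym[OF bad_ab(1)] bad_ab(2) between ya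
            unfolding eq by (auto simp: outer_def)
          then show False using contra by blast
        qed
      qed
    qed
    ultimately show ?thesis using simple_min vS by blast
  qed
qed

end

section \<open>Shortest walks and induced cycles\<close>

lemma induced_cycleI:
  assumes "length xs \<ge> 3" "distinct xs" "set xs \<subseteq> V"
    and loop: "\<And>x. {x} \<notin> E"
    and adj: "\<And>i j. i < j \<Longrightarrow> j < length xs \<Longrightarrow>
      {xs ! i, xs ! j} \<in> E \<longleftrightarrow> j = Suc i \<or> i = 0 \<and> Suc j = length xs"
  shows "induced_cycle V E xs"
proof -
  let ?n = "length xs"
  have mod: "Suc i mod ?n = (if Suc i = ?n then 0 else Suc i)" if "i < ?n" for i
    using that by auto
  have "{xs ! i, xs ! j} \<in> E \<longleftrightarrow> j = Suc i mod ?n \<or> i = Suc j mod ?n"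
    if ij: "i < ?n" "j < ?n" for i j
  proof (cases i j rule: linorder_cases)
    case less
    then show ?thesis using adj[of i j] ij assms(1) by (auto simp: mod)
  next
    case equal
    then show ?thesis using loop ij assms(1) by (auto simp: mod)
  next
    case greater
    then show ?thesis using adj[of j i] ij assms(1) by (auto simp: mod insert_commute)
  qed
  then show ?thesis using assms unfolding induced_cycle_def by blast
qed

lemma comparability_edge_iff:
  "{x, y} \<in> comparability_edges P \<longleftrightarrow> x \<in> P \<and> y \<in> P \<and> x \<noteq> y \<and> comparable (\<le>) x y"
  unfolding comparability_edges_def comparable_def
  by (auto simp: doubleton_eq_iff order.strict_iff_order)

lemma no_loop_comparability: "{x} \<notin> comparability_edges P"
  using comparability_edge_iff[of x x P] by simp

lemma chordal_no_C4:
  assumes ch: "chordal P (comparability_edges P)"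
    and P: "a \<in> P" "b \<in> P" "c \<in> P" "d \<in> P"
    and R: "comparable (\<le>) a b" "comparable (\<le>) b c" "comparable (\<le>) c d" "comparable (\<le>) d a"
  shows "comparable (\<le>) a c \<or> comparable (\<le>) b d"
proof (rule ccontr)
  assume neg: "\<not> ?thesis"
  have "distinct [a, b, c, d]" using neg R by (auto simp: comparable_def)
  moreover have "{[a, b, c, d] ! i, [a, b, c, d] ! j} \<in> comparability_edges P \<longleftrightarrow>
      j = Suc i \<or> i = 0 \<and> Suc j = length [a, b, c, d]" if ij: "i < j" "j < length [a, b, c, d]" for i j
  proof -
    have "i = 0 \<and> j = 1 \<or> i = 0 \<and> j = 2 \<or> i = 0 \<and> j = 3 \<or> i = 1 \<and> j = 2 \<or> i = 1 \<and> j = 3 \<or> i = 2 \<and> j = 3"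
      using ij by auto
    then show ?thesis
      using neg R P \<open>distinct [a, b, c, d]\<close>
      by (elim disjE conjE) (auto simp: comparability_edge_iff numeral_2_eq_2 numeral_3_eq_3 comparable_def)
  qed
  ultimately have "induced_cycle P (comparability_edges P) [a, b, c, d]"
    using P by (intro induced_cycleI no_loop_comparability) auto
  then show False using ch unfolding chordal_def by force
qed

lemma rtrancl_imp_walk:
  assumes "(p, q) \<in> (outside_step R S x y)\<^sup>*" "p \<in> S - (nbhd R S x \<inter> nbhd R S y)"
  shows "\<exists>ps. ps \<noteq> [] \<and> hd ps = p \<and> last ps = q \<and>
    set ps \<subseteq> S - (nbhd R S x \<inter> nbhd R S y) \<and> successively R ps"
  using assms
proof (induction rule: rtrancl_induct)
  case base
  then show ?case by (intro exI[of _ "[p]"]) auto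
next
  case (step q q')
  then obtain ps where "ps \<noteq> []" "hd ps = p" "last ps = q" "successively R ps"
    "set ps \<subseteq> S - (nbhd R S x \<inter> nbhd R S y)" by blast
  then show ?case using step.hyps
    by (intro exI[of _ "ps @ [q']"]) (auto simp: outside_step_def successively_append_iff)
qed

text \<open>A shortest walk around the edge, closed up by \<open>y\<close> and \<open>x\<close>, is
  an induced cycle of length at least four.\<close>

lemma chordal_separation:
  fixes P :: "'a::order set"
  defines "R \<equiv> comparable ((\<le>) :: 'a \<Rightarrow> 'a \<Rightarrow> bool)"
  assumes ch: "chordal P (comparability_edges P)" and SP: "S \<subseteq> P"
    and xy: "x \<in> S" "y \<in> S" "R x y"
    and p: "p \<in> nbhd R S y - nbhd R S x" and q: "q \<in> nbhd R S x - nbhd R S y"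
  shows "(p, q) \<notin> (outside_step R S x y)\<^sup>*"
proof
  assume pq: "(p, q) \<in> (outside_step R S x y)\<^sup>*"
  have sym: "R a b \<Longrightarrow> R b a" for a b by (auto simp: R_def comparable_def)
  have refl: "R a a" for a by (simp add: R_def comparable_def)
  let ?T = "S - (nbhd R S x \<inter> nbhd R S y)"
  \<comment> \<open>Only adjacency of the ends to \<open>y\<close> and \<open>x\<close> is
    prescribed, not \<open>p\<close> and \<open>q\<close> themselves; minimal length then keeps all
    other vertices of the walk away from \<open>x\<close> and \<open>y\<close>.\<close>
  define W where "W ps \<longleftrightarrow> ps \<noteq> [] \<and> R y (hd ps) \<and> R x (last ps) \<and> set ps \<subseteq> ?T \<and> successively R ps" for ps
  have "\<exists>ps. W ps"
    using rtrancl_imp_walk[OF pq] p q by (auto simp: W_def nbhd_def)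
  then obtain ps where W: "W ps" and min: "\<And>qs. W qs \<Longrightarrow> length ps \<le> length qs"
    using ex_has_least_nat[of W _ length] by blast
  let ?k = "length ps"
  have ne: "ps \<noteq> []" and Ry: "R y (hd ps)" and Rx: "R x (last ps)" and sub: "set ps \<subseteq> ?T"
    and walk: "successively R ps" using W by (auto simp: W_def)
  have walks: "successively R (take i ps)" "successively R (drop i ps)" for i
    using walk successively_append_iff[of R "take i ps" "drop i ps"] by auto
  have subs: "set (take i ps) \<subseteq> ?T" "set (drop i ps) \<subseteq> ?T" for i
    using sub set_take_subset[of i ps] set_drop_subset[of i ps] by blast+
  have tk: "take (Suc i) ps \<noteq> []" "hd (take (Suc i) ps) = hd ps" "last (take (Suc i) ps) = ps ! i"
    if "i < ?k" for i
    using that ne by (auto simp: take_Suc_conv_app_nth[OF that] hd_append hd_take hd_conv_nth)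
  have y_adj: "i = 0" if "i < ?k" "R y (ps ! i)" for i
  proof -
    have "W (drop i ps)"
      unfolding W_def using that Rx walks subs ne by (auto simp: hd_drop_conv_nth last_drop)
    then show ?thesis using min[of "drop i ps"] that by auto
  qed
  have x_adj: "Suc i = ?k" if "i < ?k" "R x (ps ! i)" for i
  proof -
    have "W (take (Suc i) ps)"
      unfolding W_def using that tk[OF that(1)] Ry walks(1)[of "Suc i"] subs(1)[of "Suc i"] by simp
    then show ?thesis using min[of "take (Suc i) ps"] that by auto
  qed
  have short: "j \<le> Suc i" if "i < j" "j < ?k" "R (ps ! i) (ps ! j)" for i j
  proof -
    have "W (take (Suc i) ps @ drop j ps)"
      unfolding W_def successively_append_iff
      using that tk[of i] Ry Rx walks subs(1)[of "Suc i"] subs(2)[of j] ne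
      by (simp add: hd_drop_conv_nth last_drop)
    then show ?thesis using min[of "take (Suc i) ps @ drop j ps"] that by auto
  qed
  \<comment> \<open>Reflexivity and \<open>short\<close> still admit equal consecutive vertices, so
    a repetition is cut out together with the loop it closes.\<close>
  have inj: "ps ! i \<noteq> ps ! j" if "i < j" "j < ?k" for i j
  proof
    assume eq: "ps ! i = ps ! j"
    have "R (ps ! j) (hd (drop (Suc j) ps))" if "Suc j < ?k"
      using walk that by (simp add: hd_drop_conv_nth successively_conv_nth)
    then have "successively R (take (Suc i) ps @ drop (Suc j) ps)"
      unfolding successively_append_iff using that tk(3)[of i] walks eq by (cases "Suc j < ?k") auto
    moreover have "last (take (Suc i) ps @ drop (Suc j) ps) = last ps"
    proof (cases "Suc j = ?k")
      case True
      then have "last ps = ps ! j" using ne by (metis diff_Suc_1 last_conv_nth)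
      then show ?thesis using True tk(3)[of i] that eq by simp
    next
      case False
      then show ?thesis using that by (auto simp: last_drop)
    qed
    ultimately have "W (take (Suc i) ps @ drop (Suc j) ps)"
      unfolding W_def using that tk[of i] Ry Rx subs(1)[of "Suc i"] subs(2)[of "Suc j"]
      by simp
    then show False using min[of "take (Suc i) ps @ drop (Suc j) ps"] that by auto
  qed
  have dist: "distinct ps" using inj unfolding distinct_conv_nth by (metis linorder_neqE_nat)
  have y0: "R y (ps ! 0)" and x0: "R x (ps ! (?k - 1))"
    using Ry Rx ne by (auto simp: hd_conv_nth last_conv_nth)
  \<comment> \<open>A single vertex would be a common neighbour of \<open>x\<close> and
    \<open>y\<close>, and these are deleted; with two vertices the cycle \<open>zs\<close> already
    has length four.\<close>
  have k2: "?k \<ge> 2"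
  proof (rule ccontr)
    assume "\<not> ?k \<ge> 2"
    then have "?k = 1" using ne by (simp add: not_le less_2_cases_iff)
    then obtain z where "ps = [z]" by (metis One_nat_def length_0_conv length_Suc_conv)
    then show False using x0 y0 sub by (auto simp: nbhd_def)
  qed
  have xps: "x \<notin> set ps" "y \<notin> set ps" using sub xy refl sym by (auto simp: nbhd_def)
  have "x \<noteq> y" using p q by auto
  define zs where "zs = y # ps @ [x]"
  have zs_nth: "zs ! i = (if i = 0 then y else if i = Suc ?k then x else ps ! (i - 1))"
    if "i < length zs" for i
    using that by (auto simp: zs_def nth_Cons nth_append split: nat.splits)
  have "induced_cycle P (comparability_edges P) zs"
  proof (rule induced_cycleI)
    show "length zs \<ge> 3" "distinct zs" "set zs \<subseteq> P"
      using k2 dist xps \<open>x \<noteq> y\<close> sub SP xy by (auto simp: zs_def)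
    show "{x} \<notin> comparability_edges P" for x by (rule no_loop_comparability)
    fix i j assume ij: "i < j" "j < length zs"
    then have "zs ! i \<in> P" "zs ! j \<in> P" "zs ! i \<noteq> zs ! j"
      using \<open>set zs \<subseteq> P\<close> \<open>distinct zs\<close> by (auto simp: distinct_conv_nth subset_iff)
    then have "{zs ! i, zs ! j} \<in> comparability_edges P \<longleftrightarrow> R (zs ! i) (zs ! j)"
      by (simp add: comparability_edge_iff R_def)
    also have "\<dots> \<longleftrightarrow> j = Suc i \<or> i = 0 \<and> Suc j = length zs"
    proof -
      have len: "length zs = Suc (Suc ?k)" by (simp add: zs_def)
      consider "i = 0" "j = Suc ?k" | "i = 0" "j \<le> ?k" | "i > 0" "j = Suc ?k" | "i > 0" "j \<le> ?k"
        using ij len by linarith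
      then show ?thesis
      proof cases
        case 1
        then show ?thesis using xy sym ij len zs_nth[of i] zs_nth[of j] by auto
      next
        case 2
        then have "R y (ps ! (j - 1)) \<longleftrightarrow> j = 1" using y_adj[of "j - 1"] y0 ij by (cases j) auto
        then show ?thesis using 2 ij len zs_nth[of i] zs_nth[of j] by simp
      next
        case 3
        then have "R x (ps ! (i - 1)) \<longleftrightarrow> i = ?k" using x_adj[of "i - 1"] x0 ij by auto
        then have "R (ps ! (i - 1)) x \<longleftrightarrow> i = ?k" using sym by blast
        then show ?thesis using 3 ij len zs_nth[of i] zs_nth[of j] by auto
      next
        case 4
        then obtain i' j' where [simp]: "i = Suc i'" "j = Suc j'" using ij by (metis gr0_conv_Suc less_trans)
        have "R (ps ! i') (ps ! j') \<longleftrightarrow> j' = Suc i'"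
          using 4 short[of i' j'] ij walk by (auto simp: successively_conv_nth)
        then show ?thesis using 4 ij len zs_nth[of i] zs_nth[of j] by simp
      qed
    qed
    finally show "{zs ! i, zs ! j} \<in> comparability_edges P \<longleftrightarrow> j = Suc i \<or> i = 0 \<and> Suc j = length zs" .
  qed
  then show False using ch k2 unfolding chordal_def zs_def by auto
qed

lemma chordal_strong_elimination:
  fixes P :: "'a::order set"
  assumes "finite P" and ch: "chordal P (comparability_edges P)"
  shows "\<exists>h. strong_elimination (comparable (\<le>)) P h"
proof (rule strong_elimination_exists)
  fix T assume T: "T \<subseteq> P" "T \<noteq> {}"
  have "chordal_poset (\<le>) T"
  proof
    show "finite T" using T assms finite_subset by blast
  next
    fix x y p q
    show "x \<in> T \<Longrightarrow> y \<in> T \<Longrightarrow> comparable (\<le>) x y \<Longrightarrow>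
      p \<in> nbhd (comparable (\<le>)) T y - nbhd (comparable (\<le>)) T x \<Longrightarrow>
      q \<in> nbhd (comparable (\<le>)) T x - nbhd (comparable (\<le>)) T y \<Longrightarrow>
      (p, q) \<notin> (outside_step (comparable (\<le>)) T x y)\<^sup>*"
      by (rule chordal_separation[OF ch T(1)])
  next
    fix a b c d
    assume "a \<in> T" "b \<in> T" "c \<in> T" "d \<in> T"
      "comparable (\<le>) a b" "comparable (\<le>) b c" "comparable (\<le>) c d" "comparable (\<le>) d a"
    then show "comparable (\<le>) a c \<or> comparable (\<le>) b d" using chordal_no_C4[OF ch] T by blast
  qed auto
  then show "\<exists>v. simple_vertex (comparable (\<le>)) T v" using chordal_poset.simple_vertex_exists T by blast
qed (use assms in \<open>auto simp: comparable_def\<close>)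

section \<open>Monomials and ideals\<close>

abbreviation "keys \<equiv> Poly_Mapping.keys"
abbreviation "lookup \<equiv> Poly_Mapping.lookup"
abbreviation "single \<equiv> Poly_Mapping.single"

text \<open>The image of the monomial under the toric parametrization, which sends the variable of
  \<open>C\<close> to the product of the elements of \<open>C\<close>; the multiset records the
  exponents of this image.\<close>

definition multidegree :: "'a multiset monomial \<Rightarrow> 'a multiset" where
  "multidegree u = (\<Sum>C\<in>keys u. repeat_mset (lookup u C) C)"

lemma multidegree_superset:
  assumes "finite A" "keys u \<subseteq> A"
  shows "multidegree u = (\<Sum>C\<in>A. repeat_mset (lookup u C) C)"
  unfolding multidegree_def using assms
  by (intro sum.mono_neutral_left) (auto simp: in_keys_iff)

lemma multidegree_add: "multidegree (u + w) = multidegree u + multidegree w"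
proof -
  let ?A = "keys u \<union> keys w"
  have "multidegree (u + w) = (\<Sum>C\<in>?A. repeat_mset (lookup (u + w) C) C)"
    by (intro multidegree_superset) (auto dest: subsetD[OF Poly_Mapping.keys_add])
  also have "\<dots> = multidegree u + multidegree w"
    by (simp add: multidegree_superset[of ?A] lookup_add repeat_mset_distrib sum.distrib)
  finally show ?thesis .
qed

lemma multidegree_single [simp]: "multidegree (single C n) = repeat_mset n C"
  by (simp add: multidegree_def)

lemma count_multidegree:
  assumes "finite A" "keys u \<subseteq> A"
  shows "count (multidegree u) i = (\<Sum>C\<in>A. lookup u C * count C i)"
  by (simp add: multidegree_superset[OF assms] count_sum)

lemma mono_degree_superset:
  assumes "finite A" "keys u \<subseteq> A"
  shows "mono_degree u = (\<Sum>v\<in>A. lookup u v)"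
  unfolding mono_degree_def using assms
  by (intro sum.mono_neutral_left) (auto simp: in_keys_iff)

lemma mono_degree_add: "mono_degree (u + w) = mono_degree u + mono_degree w"
proof -
  let ?A = "keys u \<union> keys w"
  have "mono_degree (u + w) = (\<Sum>C\<in>?A. lookup (u + w) C)"
    by (intro mono_degree_superset) (auto dest: subsetD[OF Poly_Mapping.keys_add])
  also have "\<dots> = mono_degree u + mono_degree w"
    by (simp add: mono_degree_superset[of ?A] lookup_add sum.distrib)
  finally show ?thesis .
qed

lemma mono_degree_single [simp]: "mono_degree (single C n) = n"
  by (simp add: mono_degree_def)

lemma keys_add_nat: "keys (u + w) = keys u \<union> keys (w :: 'v monomial)"
  by (auto simp: in_keys_iff lookup_add)

lemma monomials_add [simp]: "u + w \<in> monomials V \<longleftrightarrow> u \<in> monomials V \<and> w \<in> monomials V"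
  by (auto simp: monomials_def keys_add_nat)

lemma monomials_zero [simp]: "0 \<in> monomials V"
  by (simp add: monomials_def)

lemma monomials_single [simp]: "single v n \<in> monomials V \<longleftrightarrow> n = 0 \<or> v \<in> V"
  by (auto simp: monomials_def)

lemma size_multidegree:
  assumes "u \<in> monomials V" "\<And>C. C \<in> V \<Longrightarrow> size C = d"
  shows "size (multidegree u) = d * mono_degree u"
proof -
  have "size (repeat_mset n C) = n * size C" for n and C :: "'a multiset"
    by (induction n) auto
  moreover have "size C = d" if "C \<in> keys u" for C
    using that assms by (auto simp: monomials_def)
  ultimately show ?thesis
    by (simp add: multidegree_def mono_degree_def sum_distrib_left mult.commute)
qed

lemma monomial_split_single:
  assumes "v \<in> keys u"
  shows "\<exists>c. u = single v 1 + (c :: 'v monomial)"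
proof
  show "u = single v 1 + (u - single v 1)"
    using assms by (intro poly_mapping_eqI) (auto simp: lookup_add lookup_minus lookup_single when_def in_keys_iff)
qed

lemma mono_degree_0_iff [simp]: "mono_degree u = 0 \<longleftrightarrow> u = 0"
  by (auto simp: mono_degree_def in_keys_iff intro!: poly_mapping_eqI)

lemma mono_degree_zero [simp]: "mono_degree 0 = 0"
  by simp

lemma monomial_nonzero_key: "u \<noteq> 0 \<Longrightarrow> \<exists>v. v \<in> keys (u :: 'v monomial)"
  by (metis in_keys_iff lookup_zero poly_mapping_eqI)

lemma mono_degree_2:
  assumes "mono_degree s = 2"
  obtains C D where "s = single C 1 + single D 1"
proof -
  have "s \<noteq> 0" using assms by auto
  then obtain C where C: "C \<in> keys s" using monomial_nonzero_key by blast
  obtain s' where s: "s = single C 1 + s'" using monomial_split_single[OF C] by blast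
  have s': "mono_degree s' = 1" using s assms by (simp add: mono_degree_add)
  then have "s' \<noteq> 0" by auto
  then obtain D where D: "D \<in> keys s'" using monomial_nonzero_key by blast
  obtain s'' where s2: "s' = single D 1 + s''" using monomial_split_single[OF D] by blast
  have "s'' = 0" using s2 s' by (simp add: mono_degree_add)
  then show thesis using that s s2 by simp
qed

lemma finite_monomials_degree:
  assumes "finite V"
  shows "finite {u \<in> monomials V. mono_degree u = n}"
proof (induction n)
  case 0
  then show ?case by simp
next
  case (Suc n)
  have "{u \<in> monomials V. mono_degree u = Suc n} \<subseteq>
    (\<lambda>(v, u). single v 1 + u) ` (V \<times> {u \<in> monomials V. mono_degree u = n})"
  proof
    fix u assume u: "u \<in> {u \<in> monomials V. mono_degree u = Suc n}"
    then have "u \<noteq> 0" by auto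
    then obtain C where C: "C \<in> keys u" using monomial_nonzero_key by blast
    obtain c where c: "u = single C 1 + c" using monomial_split_single[OF C] by blast
    have "C \<in> V" using C u by (auto simp: monomials_def)
    then show "u \<in> (\<lambda>(v, u). single v 1 + u) ` (V \<times> {u \<in> monomials V. mono_degree u = n})"
      using u c by (auto simp: mono_degree_add intro!: image_eqI[of _ _ "(C, c)"])
  qed
  then show ?case using Suc assms finite_subset by blast
qed

section \<open>Polynomials and generated ideals\<close>

lemma mono_poly_add: "mono_poly (u + w) = mono_poly u * mono_poly w"
  by (simp add: mono_poly_def mult_single)

lemma keys_mono_poly [simp]: "keys (mono_poly u :: ('v, 'k::field) mpoly) = {u}"
  by (simp add: mono_poly_def)

lemma keys_mono_poly_diff:
  "u \<noteq> w \<Longrightarrow> keys (mono_poly u - mono_poly w :: ('v, 'k::field) mpoly) = {u, w}"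
  by (intro set_eqI) (auto simp add: mono_poly_def in_keys_iff lookup_minus lookup_single when_def)

lemma mono_poly_in_polys [simp]: "(mono_poly u :: ('v, 'k::field) mpoly) \<in> polys V \<longleftrightarrow> u \<in> monomials V"
  by (simp add: polys_def)

lemma polys_zero [simp]: "0 \<in> polys V"
  by (simp add: polys_def)

lemma polys_add: "p \<in> polys V \<Longrightarrow> q \<in> polys V \<Longrightarrow> p + q \<in> polys V"
  using Poly_Mapping.keys_add[of p q] by (auto simp: polys_def)

lemma polys_diff: "p \<in> polys V \<Longrightarrow> q \<in> polys V \<Longrightarrow> p - q \<in> polys V"
  using keys_diff[of p q] by (auto simp: polys_def)

lemma polys_mult: "p \<in> polys V \<Longrightarrow> q \<in> polys V \<Longrightarrow> p * q \<in> polys V"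
  using keys_mult[of p q] by (fastforce simp: polys_def)

lemma polys_sum: "(\<And>i. i \<in> A \<Longrightarrow> f i \<in> polys V) \<Longrightarrow> sum f A \<in> polys V"
  by (induction A rule: infinite_finite_induct) (auto intro: polys_add)

lemma ideal_generated_base:
  assumes "f \<in> B" "q \<in> polys V"
  shows "q * f \<in> ideal_generated V B"
  unfolding ideal_generated_def using assms
  by (intro CollectI exI[of _ "{f}"] exI[of _ "\<lambda>_. q"]) auto

lemma ideal_generated_zero [simp]: "0 \<in> ideal_generated V B"
  unfolding ideal_generated_def by (intro CollectI exI[of _ "{}"]) auto

lemma ideal_generated_add:
  assumes "f \<in> ideal_generated V B" "g \<in> ideal_generated V B"
  shows "f + g \<in> ideal_generated V B"
proof -
  obtain F q where F: "f = (\<Sum>h\<in>F. q h * h)" "finite F" "F \<subseteq> B" "\<forall>h\<in>F. q h \<in> polys V"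
    using assms(1) unfolding ideal_generated_def by blast
  obtain G r where G: "g = (\<Sum>h\<in>G. r h * h)" "finite G" "G \<subseteq> B" "\<forall>h\<in>G. r h \<in> polys V"
    using assms(2) unfolding ideal_generated_def by blast
  define q' r' where "q' h = (if h \<in> F then q h else 0)" and "r' h = (if h \<in> G then r h else 0)" for h
  have "f = (\<Sum>h\<in>F \<union> G. q' h * h)"
    unfolding F(1) using F(2) G(2) by (intro sum.mono_neutral_cong_left) (auto simp: q'_def)
  moreover have "g = (\<Sum>h\<in>F \<union> G. r' h * h)"
    unfolding G(1) using F(2) G(2) by (intro sum.mono_neutral_cong_left) (auto simp: r'_def)
  ultimately have "f + g = (\<Sum>h\<in>F \<union> G. (q' h + r' h) * h)"
    by (simp add: sum.distrib distrib_right)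
  moreover have "\<forall>h\<in>F \<union> G. q' h + r' h \<in> polys V"
    using F(4) G(4) by (auto simp: q'_def r'_def intro: polys_add)
  ultimately show ?thesis
    unfolding ideal_generated_def using F(2,3) G(2,3)
    by (intro CollectI exI[of _ "F \<union> G"] exI[of _ "\<lambda>h. q' h + r' h"]) auto
qed

lemma ideal_generated_sum:
  "(\<And>i. i \<in> A \<Longrightarrow> f i \<in> ideal_generated V B) \<Longrightarrow> sum f A \<in> ideal_generated V B"
  by (induction A rule: infinite_finite_induct) (auto intro: ideal_generated_add)

lemma ideal_generated_mult:
  assumes "f \<in> ideal_generated V B" "p \<in> polys V"
  shows "p * f \<in> ideal_generated V B"
proof -
  obtain F q where F: "f = (\<Sum>h\<in>F. q h * h)" "finite F" "F \<subseteq> B" "\<forall>h\<in>F. q h \<in> polys V"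
    using assms(1) unfolding ideal_generated_def by blast
  have "p * f = (\<Sum>h\<in>F. (p * q h) * h)" by (simp add: F(1) sum_distrib_left mult.assoc)
  also have "\<dots> \<in> ideal_generated V B"
    using F assms(2) by (intro ideal_generated_sum ideal_generated_base) (auto intro: polys_mult)
  finally show ?thesis .
qed

lemma ideal_generated_least:
  assumes "B \<subseteq> ideal_generated V B'"
  shows "ideal_generated V B \<subseteq> ideal_generated V B'"
proof
  fix f assume "f \<in> ideal_generated V B"
  then obtain F q where F: "f = (\<Sum>h\<in>F. q h * h)" "finite F" "F \<subseteq> B" "\<forall>h\<in>F. q h \<in> polys V"
    unfolding ideal_generated_def by blast
  show "f \<in> ideal_generated V B'"
    unfolding F(1) using F assms by (intro ideal_generated_sum ideal_generated_mult) auto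
qed

lemma ideal_generated_subset_polys:
  assumes "B \<subseteq> polys V" shows "ideal_generated V B \<subseteq> polys V"
  using assms unfolding ideal_generated_def by (auto intro!: polys_sum polys_mult)

lemma one_in_polys [simp]: "1 \<in> polys V"
  by (simp add: polys_def)

lemma subset_ideal_generated: "B \<subseteq> ideal_generated V B"
  using ideal_generated_base[of _ B 1 V] by auto

lemma ideal_generated_mono: "B \<subseteq> B' \<Longrightarrow> ideal_generated V B \<subseteq> ideal_generated V B'"
  using ideal_generated_least[of B V B'] subset_ideal_generated[of B' V] by simp

text \<open>\<open>u\<close> must occur in some summand \<open>q h * h\<close>, and every term of
  that summand is a multiple of the generator \<open>h\<close>.\<close>

lemma monomial_in_monomial_ideal:
  assumes "mono_poly u \<in> (ideal_generated V (mono_poly ` M) :: ('v, 'k::field) mpoly set)"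
  shows "\<exists>s\<in>M. \<exists>c. u = s + c"
proof -
  obtain F and q :: "('v, 'k) mpoly \<Rightarrow> ('v, 'k) mpoly"
    where F: "mono_poly u = (\<Sum>h\<in>F. q h * h)" "F \<subseteq> mono_poly ` M"
    using assms unfolding ideal_generated_def by blast
  have "u \<in> keys (\<Sum>h\<in>F. q h * h)" unfolding F(1)[symmetric] by simp
  then obtain h where h: "h \<in> F" "u \<in> keys (q h * h)" using keys_sum[of "\<lambda>h. q h * h" F] by blast
  then obtain s where s: "s \<in> M" "h = mono_poly s" using F by blast
  then obtain c where "u = c + s" using h(2) subsetD[OF keys_mult h(2)] by auto
  then have "u = s + c" by (simp add: add.commute)
  then show ?thesis using s(1) by blast
qed

text \<open>A linear functional that kills all multiples of a binomial whose two terms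
  \<open>T\<close> cannot tell apart. It is used with \<open>T\<close> a fibre of the multidegree
  and with \<open>T\<close> a class of monomials linked by quadratic moves.\<close>

definition coeff_sum :: "'v monomial set \<Rightarrow> ('v, 'k::field) mpoly \<Rightarrow> 'k" where
  "coeff_sum T f = (\<Sum>m\<in>keys f. if m \<in> T then lookup f m else 0)"

lemma coeff_sum_superset:
  assumes "finite A" "keys f \<subseteq> A"
  shows "coeff_sum T f = (\<Sum>m\<in>A. if m \<in> T then lookup f m else 0)"
  unfolding coeff_sum_def using assms
  by (intro sum.mono_neutral_left) (auto simp: in_keys_iff)

lemma coeff_sum_diff: "coeff_sum T (f - g) = coeff_sum T f - coeff_sum T g"
proof -
  let ?A = "keys f \<union> keys g"
  have "coeff_sum T (f - g) = (\<Sum>m\<in>?A. if m \<in> T then lookup (f - g) m else 0)"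
    by (intro coeff_sum_superset) (auto dest: subsetD[OF keys_diff])
  also have "\<dots> = (\<Sum>m\<in>?A. (if m \<in> T then lookup f m else 0) - (if m \<in> T then lookup g m else 0))"
    by (intro sum.cong) (auto simp: lookup_minus)
  also have "\<dots> = coeff_sum T f - coeff_sum T g"
    by (simp add: coeff_sum_superset[of ?A] sum_subtractf)
  finally show ?thesis .
qed

lemma coeff_sum_zero [simp]: "coeff_sum T 0 = 0"
  by (simp add: coeff_sum_def)

lemma coeff_sum_add: "coeff_sum T (f + g) = coeff_sum T f + coeff_sum T g"
  using coeff_sum_diff[of T "f + g" g] by simp

lemma coeff_sum_sum: "coeff_sum T (sum f A) = (\<Sum>i\<in>A. coeff_sum T (f i))"
  by (induction A rule: infinite_finite_induct) (auto simp: coeff_sum_add)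

lemma coeff_sum_single: "coeff_sum T (single m c) = (if m \<in> T then c else 0)"
  by (simp add: coeff_sum_def)

lemma sum_single_lookup: "(\<Sum>m\<in>keys q. single m (lookup q m)) = q"
  by (intro poly_mapping_eqI)
    (auto simp: lookup_sum lookup_single when_def in_keys_iff)

lemma coeff_sum_mult_binomial:
  assumes "\<And>m. m + s \<in> T \<longleftrightarrow> m + t \<in> T"
  shows "coeff_sum T (q * (mono_poly s - mono_poly t)) = 0"
proof -
  have "q * (mono_poly s - mono_poly t) =
      (\<Sum>m\<in>keys q. single (m + s) (lookup q m) - single (m + t) (lookup q m))"
    by (subst (1) sum_single_lookup[of q, symmetric], simp only: sum_distrib_right)
      (simp add: right_diff_distrib mono_poly_def mult_single)
  then show ?thesis by (simp add: coeff_sum_sum coeff_sum_diff coeff_sum_single assms)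
qed

lemma coeff_sum_ideal:
  assumes "f \<in> ideal_generated V B"
    and "\<And>g. g \<in> B \<Longrightarrow> \<exists>s t. g = mono_poly s - mono_poly t \<and> (\<forall>m. m + s \<in> T \<longleftrightarrow> m + t \<in> T)"
  shows "coeff_sum T f = 0"
proof -
  obtain F q where F: "f = (\<Sum>h\<in>F. q h * h)" "F \<subseteq> B"
    using assms(1) unfolding ideal_generated_def by blast
  have "coeff_sum T (q h * h) = 0" if "h \<in> F" for h
    using assms(2)[of h] that F(2) coeff_sum_mult_binomial by blast
  then show ?thesis by (simp add: F(1) coeff_sum_sum)
qed

definition pos_part :: "'v set \<Rightarrow> ('v \<Rightarrow> int) \<Rightarrow> 'v monomial" where
  "pos_part V b = (\<Sum>v\<in>{v\<in>V. b v > 0}. single v (nat (b v)))"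

lemma var_power: "var v ^ n = mono_poly (single v n)"
  by (induction n) (auto simp: var_def mono_poly_def mult_single single_add[symmetric])

lemma prod_var_power:
  "finite A \<Longrightarrow> (\<Prod>v\<in>A. var v ^ n v) = mono_poly (\<Sum>v\<in>A. single v (n v))"
  by (induction A rule: finite_induct) (simp_all add: var_power mono_poly_add, simp add: mono_poly_def)

lemma toric_binomial_eq:
  assumes "finite V"
  shows "toric_binomial V b = mono_poly (pos_part V b) - mono_poly (pos_part V (\<lambda>v. - b v))"
  using assms by (simp add: toric_binomial_def pos_part_def prod_var_power)

lemma lookup_pos_part:
  assumes "finite V"
  shows "lookup (pos_part V b) v = (if v \<in> V then nat (b v) else 0)"
  using assms by (auto simp: pos_part_def lookup_sum lookup_single when_def)

lemma pos_part_in_monomials: "finite V \<Longrightarrow> pos_part V b \<in> monomials V"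
  by (auto simp: monomials_def in_keys_iff lookup_pos_part split: if_splits)

lemma rho_eq_count: "rho C i = int (count C i)"
  unfolding rho_def by (induction C) auto

section \<open>Toric ideals and connectivity of fibres\<close>

lemma initial_monomial_eqI:
  assumes "monomial_order V r" "keys f \<subseteq> monomials V" "u \<in> keys f" "\<And>w. w \<in> keys f \<Longrightarrow> (w, u) \<in> r"
  shows "initial_monomial r f = u"
  unfolding initial_monomial_def
proof (rule the_equality)
  show "u \<in> keys f \<and> (\<forall>w\<in>keys f. (w, u) \<in> r)" using assms by blast
next
  fix v assume "v \<in> keys f \<and> (\<forall>w\<in>keys f. (w, v) \<in> r)"
  then have "(u, v) \<in> r" "(v, u) \<in> r" using assms by blast+
  moreover have "antisym r"
    using assms(1) by (auto simp: monomial_order_def linear_order_on_def partial_order_on_def)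
  ultimately show "v = u" by (auto dest: antisymD)
qed

lemma monomial_order_total:
  "monomial_order V r \<Longrightarrow> u \<in> monomials V \<Longrightarrow> w \<in> monomials V \<Longrightarrow> (u, w) \<in> r \<or> (w, u) \<in> r"
  unfolding monomial_order_def linear_order_on_def partial_order_on_def preorder_on_def total_on_def refl_on_def
  by metis

lemma monomial_order_refl: "monomial_order V r \<Longrightarrow> u \<in> monomials V \<Longrightarrow> (u, u) \<in> r"
  using monomial_order_total by blast

lemma monomial_order_trans: "monomial_order V r \<Longrightarrow> (u, v) \<in> r \<Longrightarrow> (v, w) \<in> r \<Longrightarrow> (u, w) \<in> r"
  unfolding monomial_order_def linear_order_on_def partial_order_on_def preorder_on_def
  by (blast dest: transD)

lemma monomial_order_antisym: "monomial_order V r \<Longrightarrow> (u, v) \<in> r \<Longrightarrow> (v, u) \<in> r \<Longrightarrow> u = v"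
  unfolding monomial_order_def linear_order_on_def partial_order_on_def
  by (blast dest: antisymD)

lemma monomial_order_add:
  "monomial_order V r \<Longrightarrow> u \<in> monomials V \<Longrightarrow> v \<in> monomials V \<Longrightarrow> w \<in> monomials V \<Longrightarrow>
    (u, v) \<in> r \<Longrightarrow> (u + w, v + w) \<in> r"
  unfolding monomial_order_def by blast

lemma monomial_order_max:
  assumes r: "monomial_order V r" and "finite A" "A \<noteq> {}" "A \<subseteq> monomials V"
  shows "\<exists>u\<in>A. \<forall>w\<in>A. (w, u) \<in> r"
  using assms(2-4)
proof (induction A rule: finite_ne_induct)
  case (singleton x)
  then show ?case using monomial_order_refl[OF r] by auto
next
  case (insert x A)
  then obtain u where u: "u \<in> A" "\<forall>w\<in>A. (w, u) \<in> r" by blast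
  have "(x, u) \<in> r \<or> (u, x) \<in> r" using monomial_order_total[OF r] u insert.prems by blast
  then show ?case
    using u insert.prems monomial_order_refl[OF r] monomial_order_trans[OF r] by (metis insert_iff insert_subset)
qed

lemma monomial_order_min:
  assumes r: "monomial_order V r" and "finite A" "A \<noteq> {}" "A \<subseteq> monomials V"
  shows "\<exists>u\<in>A. \<forall>w\<in>A. (u, w) \<in> r"
  using assms(2-4)
proof (induction A rule: finite_ne_induct)
  case (singleton x)
  then show ?case using monomial_order_refl[OF r] by auto
next
  case (insert x A)
  then obtain u where u: "u \<in> A" "\<forall>w\<in>A. (u, w) \<in> r" by blast
  have "(x, u) \<in> r \<or> (u, x) \<in> r" using monomial_order_total[OF r] u insert.prems by blast
  then show ?case
    using u insert.prems monomial_order_refl[OF r] monomial_order_trans[OF r] by (metis insert_iff insert_subset)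
qed

lemma initial_monomial_properties:
  assumes r: "monomial_order V r" and f: "f \<in> polys V" "f \<noteq> 0"
  shows "initial_monomial r f \<in> keys f" "\<And>w. w \<in> keys f \<Longrightarrow> (w, initial_monomial r f) \<in> r"
proof -
  have sub: "keys f \<subseteq> monomials V" using f by (simp add: polys_def)
  obtain u where u: "u \<in> keys f" "\<And>w. w \<in> keys f \<Longrightarrow> (w, u) \<in> r"
    using monomial_order_max[OF r, of "keys f"] f sub by auto
  then have "initial_monomial r f = u" using initial_monomial_eqI[OF r sub] by blast
  then show "initial_monomial r f \<in> keys f" "\<And>w. w \<in> keys f \<Longrightarrow> (w, initial_monomial r f) \<in> r"
    using u by blast+
qed

lemma initial_monomial_binomial:
  fixes u w :: "'v monomial"
  assumes r: "monomial_order V r" and "u \<in> monomials V" "w \<in> monomials V" "u \<noteq> w" "(w, u) \<in> r"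
  shows "initial_monomial r (mono_poly u - mono_poly w :: ('v, 'k::field) mpoly) = u"
  by (rule initial_monomial_eqI[OF r]) (use assms monomial_order_refl[OF r] in \<open>auto simp: keys_mono_poly_diff\<close>)

text \<open>The constant size \<open>d\<close> of the columns makes the toric ideal homogeneous:
  fibres are finite, and both terms of a binomial in the ideal have the same degree.\<close>

locale multiset_configuration =
  fixes P :: "'a set" and V :: "'a multiset set" and d :: nat
  assumes fin_V: "finite V" and V_sub: "C \<in> V \<Longrightarrow> set_mset C \<subseteq> P"
    and V_size: "C \<in> V \<Longrightarrow> size C = d" and d_pos: "d > 0"
begin

lemma same_degree:
  assumes "u \<in> monomials V" "w \<in> monomials V" "multidegree u = multidegree w"
  shows "mono_degree u = mono_degree w"
  using size_multidegree[OF assms(1) V_size] size_multidegree[OF assms(2) V_size] assms(3) d_pos by simp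

text \<open>The two sides differ at \<open>i\<close> by the entry of the matrix product in row
  \<open>i\<close>; rows outside \<open>P\<close> vanish because members of \<open>V\<close> have
  their elements in \<open>P\<close>.\<close>

lemma multidegree_pos_part_eq_iff:
  "multidegree (pos_part V b) = multidegree (pos_part V (\<lambda>v. - b v)) \<longleftrightarrow>
    (\<forall>i\<in>P. (\<Sum>C\<in>V. rho C i * b C) = 0)"
proof -
  have sub: "keys (pos_part V c) \<subseteq> V" for c
    using pos_part_in_monomials[OF fin_V] by (auto simp: monomials_def)
  have eq: "int (count (multidegree (pos_part V b)) i) - int (count (multidegree (pos_part V (\<lambda>v. - b v))) i) =
    (\<Sum>C\<in>V. rho C i * b C)" for i
    unfolding count_multidegree[OF fin_V sub] of_nat_sum sum_subtractf[symmetric]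
    by (intro sum.cong) (auto simp: lookup_pos_part[OF fin_V] rho_eq_count algebra_simps nat_eq_iff max_def
        split: if_splits)
  have zero: "(\<Sum>C\<in>V. rho C i * b C) = 0" if "i \<notin> P" for i
    using that V_sub by (intro sum.neutral) (auto simp: rho_eq_count not_in_iff[symmetric])
  show ?thesis
  proof
    assume "multidegree (pos_part V b) = multidegree (pos_part V (\<lambda>v. - b v))"
    then show "\<forall>i\<in>P. (\<Sum>C\<in>V. rho C i * b C) = 0" using eq by (metis diff_self)
  next
    assume "\<forall>i\<in>P. (\<Sum>C\<in>V. rho C i * b C) = 0"
    then have "(\<Sum>C\<in>V. rho C i * b C) = 0" for i using zero by blast
    then show "multidegree (pos_part V b) = multidegree (pos_part V (\<lambda>v. - b v))"
      using eq by (intro multiset_eqI) (metis eq_iff_diff_eq_0 of_nat_eq_iff)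
  qed
qed

lemma binomial_in_toric:
  assumes u: "u \<in> monomials V" and w: "w \<in> monomials V" and eq: "multidegree u = multidegree w"
  shows "mono_poly u - mono_poly w \<in> (toric_ideal P V rho :: ('a multiset, 'k::field) mpoly set)"
proof -
  define b where "b v = int (lookup u v) - int (lookup w v)" for v
  \<comment> \<open>\<open>c\<close> is the greatest common divisor of the two monomials; what
    remains of \<open>u\<close> and \<open>w\<close> are the positive and negative parts of
    \<open>b\<close>.\<close>
  define c where "c = u - pos_part V b"
  have u0: "lookup u v = 0" "lookup w v = 0" if "v \<notin> V" for v
    using that u w by (auto simp: monomials_def in_keys_iff)
  have cu: "u = pos_part V b + c" and cw: "w = pos_part V (\<lambda>v. - b v) + c"
    unfolding c_def using u0
    by (auto simp: lookup_add lookup_minus lookup_pos_part[OF fin_V] b_def intro!: poly_mapping_eqI)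
  have "c \<in> monomials V" using u cu by (metis monomials_add)
  have "multidegree (pos_part V b) = multidegree (pos_part V (\<lambda>v. - b v))"
    using eq cu cw multidegree_add by (metis add_right_cancel)
  then have cond: "\<forall>i\<in>P. (\<Sum>C\<in>V. rho C i * b C) = 0" using multidegree_pos_part_eq_iff by blast
  have "mono_poly u - mono_poly w = mono_poly c * (toric_binomial V b :: ('a multiset, 'k) mpoly)"
    unfolding toric_binomial_eq[OF fin_V] right_diff_distrib mono_poly_add[symmetric]
    by (metis add.commute cu cw)
  also have "\<dots> \<in> toric_ideal P V rho"
    unfolding toric_ideal_def using cond \<open>c \<in> monomials V\<close>
    by (intro ideal_generated_base) auto
  finally show ?thesis .
qed

lemma toric_subset_polys: "(toric_ideal P V rho :: ('a multiset, 'k::field) mpoly set) \<subseteq> polys V"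
  unfolding toric_ideal_def
  by (intro ideal_generated_subset_polys)
    (auto simp: toric_binomial_eq[OF fin_V] intro!: polys_diff pos_part_in_monomials[OF fin_V])

lemma toric_coeff_sum:
  assumes "(f :: ('a multiset, 'k::field) mpoly) \<in> toric_ideal P V rho"
  shows "coeff_sum {u. multidegree u = a} f = 0"
proof (rule coeff_sum_ideal)
  show "f \<in> ideal_generated V {toric_binomial V b | b. \<forall>i\<in>P. (\<Sum>v\<in>V. rho v i * b v) = 0}"
    using assms by (simp add: toric_ideal_def)
next
  fix g :: "('a multiset, 'k) mpoly"
  assume "g \<in> {toric_binomial V b | b. \<forall>i\<in>P. (\<Sum>v\<in>V. rho v i * b v) = 0}"
  then obtain b where "g = toric_binomial V b" "\<forall>i\<in>P. (\<Sum>v\<in>V. rho v i * b v) = 0" by blast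
  then show "\<exists>s t. g = mono_poly s - mono_poly t \<and>
      (\<forall>m. m + s \<in> {u. multidegree u = a} \<longleftrightarrow> m + t \<in> {u. multidegree u = a})"
    using multidegree_pos_part_eq_iff[of b] toric_binomial_eq[OF fin_V, of b]
    by (intro exI[of _ "pos_part V b"] exI[of _ "pos_part V (\<lambda>v. - b v)"]) (simp add: multidegree_add)
qed

lemma toric_binomial_multidegree:
  assumes "mono_poly u - mono_poly w \<in> (toric_ideal P V rho :: ('a multiset, 'k::field) mpoly set)"
  shows "multidegree u = multidegree w"
  using toric_coeff_sum[OF assms, of "multidegree u"]
  by (auto simp: coeff_sum_diff mono_poly_def coeff_sum_single split: if_splits)

definition quad_move :: "'a multiset monomial rel" where
  "quad_move = {(s + c, t + c) | s t c. s \<in> monomials V \<and> t \<in> monomials V \<and>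
     mono_degree s = 2 \<and> multidegree s = multidegree t}"

definition fibers_connected :: bool where
  "fibers_connected \<longleftrightarrow> (\<forall>u\<in>monomials V. \<forall>w\<in>monomials V.
     multidegree u = multidegree w \<longrightarrow> (u, w) \<in> quad_move\<^sup>*)"

lemma quad_moveI:
  "s \<in> monomials V \<Longrightarrow> t \<in> monomials V \<Longrightarrow> mono_degree s = 2 \<Longrightarrow> multidegree s = multidegree t \<Longrightarrow>
    (s + c, t + c) \<in> quad_move"
  unfolding quad_move_def by blast

lemma sym_quad_move: "sym quad_move"
proof (rule symI)
  fix u w assume "(u, w) \<in> quad_move"
  then obtain s t c where st: "u = s + c" "w = t + c" "s \<in> monomials V" "t \<in> monomials V"
    "mono_degree s = 2" "multidegree s = multidegree t"
    unfolding quad_move_def by blast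
  then have "mono_degree t = 2" using same_degree[OF st(3,4,6)] by simp
  then show "(w, u) \<in> quad_move" using quad_moveI[OF st(4,3)] st by simp
qed

lemma quadratic_binomial_iff:
  assumes "s \<noteq> t" "s \<in> monomials V" "t \<in> monomials V" "multidegree s = multidegree t"
  shows "quadratic_binomial (mono_poly s - mono_poly t :: ('a multiset, 'k::field) mpoly) \<longleftrightarrow> mono_degree s = 2"
proof -
  have "total_degree (mono_poly s - mono_poly t :: ('a multiset, 'k) mpoly) = mono_degree s"
    using assms same_degree[OF assms(2-4)] by (simp add: total_degree_def keys_mono_poly_diff)
  then show ?thesis using assms(1) unfolding quadratic_binomial_def by auto
qed

lemma quadratic_binomial_in_toric:
  fixes g :: "('a multiset, 'k::field) mpoly"
  assumes "quadratic_binomial g" "g \<in> toric_ideal P V rho"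
  obtains s t where "g = mono_poly s - mono_poly t" "s \<noteq> t" "s \<in> monomials V" "t \<in> monomials V"
    "mono_degree s = 2" "multidegree s = multidegree t"
proof -
  obtain s t where st: "s \<noteq> t" "g = mono_poly s - mono_poly t"
    using assms(1) by (auto simp: quadratic_binomial_def)
  have "g \<in> polys V" using assms(2) toric_subset_polys by blast
  then have V: "s \<in> monomials V" "t \<in> monomials V" using st by (auto simp: polys_def keys_mono_poly_diff)
  have eq: "multidegree s = multidegree t" using toric_binomial_multidegree assms(2) st by blast
  have "mono_degree s = 2" using quadratic_binomial_iff[OF st(1) V eq] assms(1) st by blast
  then show thesis using that st V eq by blast
qed

text \<open>Summing coefficients over the class \<open>T\<close> of \<open>u\<close> kills every
  multiple of a quadratic binomial of the ideal, hence the ideal and \<open>u - w\<close> in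
  particular. As \<open>u\<close> contributes 1, so must \<open>w\<close>.\<close>

lemma generated_imp_connected:
  assumes "generated_by_quadratic_binomials V (toric_ideal P V rho :: ('a multiset, 'k::field) mpoly set)"
  shows fibers_connected
  unfolding fibers_connected_def
proof (intro ballI impI)
  fix u w assume uw: "u \<in> monomials V" "w \<in> monomials V" "multidegree u = multidegree w"
  let ?I = "toric_ideal P V rho :: ('a multiset, 'k) mpoly set"
  obtain B where B: "\<And>f. f \<in> B \<Longrightarrow> quadratic_binomial f" "?I = ideal_generated V B"
    using assms unfolding generated_by_quadratic_binomials_def by blast
  define T where "T = {v. (u, v) \<in> quad_move\<^sup>*}"
  have "coeff_sum T (mono_poly u - mono_poly w :: ('a multiset, 'k) mpoly) = 0"
  proof (rule coeff_sum_ideal)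
    show "mono_poly u - mono_poly w \<in> ideal_generated V B" using binomial_in_toric[OF uw, where 'k = 'k] B(2) by simp
  next
    fix g assume g: "g \<in> B"
    then have "g \<in> ?I" using B(2) subset_ideal_generated by blast
    then obtain s t where st: "g = mono_poly s - mono_poly t" "s \<in> monomials V" "t \<in> monomials V"
      "mono_degree s = 2" "multidegree s = multidegree t"
      using quadratic_binomial_in_toric B(1)[OF g] by metis
    have mv: "(m + s, m + t) \<in> quad_move" for m
      using quad_moveI[OF st(2-5), of m] by (simp add: add.commute)
    then have "m + s \<in> T \<longleftrightarrow> m + t \<in> T" for m
      unfolding T_def using mv symD[OF sym_quad_move mv]
      by (auto intro: rtrancl.rtrancl_into_rtrancl)
    then show "\<exists>s t. g = mono_poly s - mono_poly t \<and> (\<forall>m. m + s \<in> T \<longleftrightarrow> m + t \<in> T)" using st by blast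
  qed
  moreover have "u \<in> T" by (simp add: T_def)
  ultimately have "w \<in> T"
    by (auto simp: coeff_sum_diff mono_poly_def coeff_sum_single split: if_splits)
  then show "(u, w) \<in> quad_move\<^sup>*" by (simp add: T_def)
qed

text \<open>Along a path of moves the binomial of the two end points telescopes into monomial
  multiples of quadratic binomials.\<close>

lemma connected_imp_generated:
  assumes conn: fibers_connected
  shows "generated_by_quadratic_binomials V (toric_ideal P V rho :: ('a multiset, 'k::field) mpoly set)"
  unfolding generated_by_quadratic_binomials_def
proof (intro exI conjI ballI)
  let ?I = "toric_ideal P V rho :: ('a multiset, 'k) mpoly set"
  define B where "B = {g \<in> ?I. quadratic_binomial g}"
  show "B \<subseteq> polys V" using toric_subset_polys by (auto simp: B_def)
  show "quadratic_binomial f" if "f \<in> B" for f using that by (simp add: B_def)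
  show "?I = ideal_generated V B"
  proof
    have "B \<subseteq> ?I" by (auto simp: B_def)
    then show "ideal_generated V B \<subseteq> ?I"
      unfolding toric_ideal_def by (rule ideal_generated_least)
    have step: "mono_poly u - mono_poly w \<in> ideal_generated V B"
      if "(u, w) \<in> quad_move\<^sup>*" "u \<in> monomials V" for u w
      using that
    proof (induction rule: rtrancl_induct)
      case base
      then show ?case by simp
    next
      case (step v w)
      obtain s t c where st: "v = s + c" "w = t + c" "s \<in> monomials V" "t \<in> monomials V"
        "mono_degree s = 2" "multidegree s = multidegree t"
        using step.hyps(2) unfolding quad_move_def by blast
      have "v \<in> monomials V" using step.hyps(1) step.prems
        by (induction rule: rtrancl_induct) (auto simp: quad_move_def)
      then have c: "c \<in> monomials V" using st by simp
      have "mono_poly v - mono_poly w \<in> ideal_generated V B"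
      proof (cases "s = t")
        case False
        then have "mono_poly s - mono_poly t \<in> B"
          using st quadratic_binomial_iff binomial_in_toric by (auto simp: B_def)
        moreover have "mono_poly v - mono_poly w = mono_poly c * (mono_poly s - mono_poly t :: ('a multiset, 'k) mpoly)"
          unfolding right_diff_distrib mono_poly_add[symmetric] by (simp add: st add.commute)
        ultimately show ?thesis using ideal_generated_base[of _ B "mono_poly c"] c by simp
      qed (simp add: st)
      then have "(mono_poly u - mono_poly v) + (mono_poly v - mono_poly w) \<in> ideal_generated V B"
        using step by (intro ideal_generated_add) auto
      then show ?case by simp
    qed
    show "?I \<subseteq> ideal_generated V B"
      unfolding toric_ideal_def
    proof (rule ideal_generated_least, safe)
      fix b assume "\<forall>i\<in>P. (\<Sum>v\<in>V. rho v i * b v) = 0"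
      then have "multidegree (pos_part V b) = multidegree (pos_part V (\<lambda>v. - b v))"
        using multidegree_pos_part_eq_iff by blast
      then show "toric_binomial V b \<in> ideal_generated V B"
        unfolding toric_binomial_eq[OF fin_V]
        using conn step pos_part_in_monomials[OF fin_V] unfolding fibers_connected_def by blast
    qed
  qed
qed

text \<open>If \<open>w\<close> lies below \<open>u\<close> in its fibre, \<open>u\<close> is the
  initial monomial of \<open>u - w\<close>, so a quadratic initial monomial divides it, and
  replacing that divisor is a move downwards. All members of a fibre thus descend to its least
  one.\<close>

lemma groebner_imp_connected:
  assumes "has_quadratic_groebner_basis V (toric_ideal P V rho :: ('a multiset, 'k::field) mpoly set)"
  shows fibers_connected
proof -
  let ?I = "toric_ideal P V rho :: ('a multiset, 'k) mpoly set"
  obtain r G where r: "monomial_order V r" and GB: "groebner_basis V r ?I G"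
    and G: "\<And>g. g \<in> G \<Longrightarrow> quadratic_binomial g"
    using assms unfolding has_quadratic_groebner_basis_def by blast
  have reduce: "\<exists>u'\<in>monomials V. (u, u') \<in> quad_move \<and> (u', u) \<in> r \<and> u' \<noteq> u \<and> multidegree u' = multidegree u"
    if u: "u \<in> monomials V" and w: "w \<in> monomials V" "multidegree u = multidegree w" "u \<noteq> w" "(w, u) \<in> r" for u w
  proof -
    let ?f = "mono_poly u - mono_poly w :: ('a multiset, 'k) mpoly"
    have "?f \<in> ?I - {0}" using binomial_in_toric[OF u w(1,2)] keys_mono_poly_diff[OF w(3), where 'k = 'k] by auto
    moreover have "initial_monomial r ?f = u" using initial_monomial_binomial[OF r u w(1,3,4)] .
    ultimately have "mono_poly u \<in> (\<lambda>f. mono_poly (initial_monomial r f)) ` (?I - {0})" by force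
    then have "mono_poly u \<in> initial_ideal V r ?I"
      unfolding initial_ideal_def by (rule subsetD[OF subset_ideal_generated])
    then have "mono_poly u \<in> ideal_generated V (mono_poly ` (initial_monomial r ` G) :: ('a multiset, 'k) mpoly set)"
      using GB by (simp add: groebner_basis_def image_image)
    then obtain g c where g: "g \<in> G" "u = initial_monomial r g + c"
      using monomial_in_monomial_ideal by blast
    have gI: "g \<in> ?I" "g \<noteq> 0" using g(1) GB by (auto simp: groebner_basis_def)
    obtain s t where st: "g = mono_poly s - mono_poly t" "s \<noteq> t" "s \<in> monomials V" "t \<in> monomials V"
      "mono_degree s = 2" "multidegree s = multidegree t"
      using quadratic_binomial_in_toric[OF G[OF g(1)] gI(1)] by metis
    have gk: "keys g = {s, t}" using st by (simp add: keys_mono_poly_diff)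
    have init: "initial_monomial r g \<in> keys g" "\<And>w. w \<in> keys g \<Longrightarrow> (w, initial_monomial r g) \<in> r"
      using initial_monomial_properties[OF r _ gI(2)] gI(1) toric_subset_polys by blast+
    \<comment> \<open>Either term of the generator may be the initial one; \<open>s'\<close> names
      it.\<close>
    obtain s' t' where st': "initial_monomial r g = s'" "(t', s') \<in> r" "s' \<noteq> t'" "s' \<in> monomials V" "t' \<in> monomials V"
      "mono_degree s' = 2" "multidegree s' = multidegree t'"
    proof (cases "initial_monomial r g = s")
      case True
      then show thesis using that[of s t] init(2)[of t] gk st by simp
    next
      case False
      then have "initial_monomial r g = t" using init(1) gk by simp
      then show thesis using that[of t s] init(2)[of s] gk st same_degree[OF st(3,4,6)] by simp
    qed
    have c: "c \<in> monomials V" using u g st' by simp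
    have "(u, t' + c) \<in> quad_move" using quad_moveI[OF st'(4-7)] g st' by simp
    moreover have "(t' + c, u) \<in> r" using monomial_order_add[OF r st'(5,4) c st'(2)] g st' by simp
    moreover have "t' + c \<noteq> u" "multidegree (t' + c) = multidegree u" "t' + c \<in> monomials V"
      using g st' c by (auto simp: multidegree_add)
    ultimately show ?thesis by blast
  qed
  show ?thesis
    unfolding fibers_connected_def
  proof (intro ballI impI)
    fix u0 w0 assume uw: "u0 \<in> monomials V" "w0 \<in> monomials V" "multidegree u0 = multidegree w0"
    define F where "F = {u \<in> monomials V. multidegree u = multidegree u0}"
    have "F \<subseteq> {u \<in> monomials V. mono_degree u = mono_degree u0}"
      using same_degree[OF _ uw(1)] by (auto simp: F_def)
    then have finF: "finite F" using finite_monomials_degree[OF fin_V] finite_subset by blast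
    have down: "(u, w) \<in> quad_move\<^sup>*"
      if uF: "u \<in> F" and wF: "w \<in> F" "\<And>v. v \<in> F \<Longrightarrow> (v, w) \<in> r \<Longrightarrow> v = w" for u w
      using uF
    \<comment> \<open>Finiteness of the fibre supplies the measure: the number of its members below
      \<open>u\<close> drops with every reduction.\<close>
    proof (induction "card {v \<in> F. (v, u) \<in> r}" arbitrary: u rule: less_induct)
      case less
      show ?case
      proof (cases "u = w")
        case False
        then have "(w, u) \<in> r"
          using monomial_order_total[OF r, of u w] wF less.prems by (auto simp: F_def)
        then obtain u' where u': "u' \<in> F" "(u, u') \<in> quad_move" "(u', u) \<in> r" "u' \<noteq> u"
          using reduce[of u w] False wF(1) less.prems by (auto simp: F_def)
        have "u \<in> {v \<in> F. (v, u) \<in> r}" "u \<notin> {v \<in> F. (v, u') \<in> r}"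
          using u' monomial_order_antisym[OF r] monomial_order_refl[OF r] less.prems by (auto simp: F_def)
        moreover have "{v \<in> F. (v, u') \<in> r} \<subseteq> {v \<in> F. (v, u) \<in> r}"
          using u'(3) monomial_order_trans[OF r] by blast
        ultimately have "{v \<in> F. (v, u') \<in> r} \<subset> {v \<in> F. (v, u) \<in> r}" by blast
        then have "card {v \<in> F. (v, u') \<in> r} < card {v \<in> F. (v, u) \<in> r}"
          using finF by (intro psubset_card_mono) auto
        then have "(u', w) \<in> quad_move\<^sup>*" using less.hyps u'(1) by blast
        then show ?thesis using u'(2) by (simp add: converse_rtrancl_into_rtrancl)
      qed simp
    qed
    obtain w where "w \<in> F" "\<And>v. v \<in> F \<Longrightarrow> (w, v) \<in> r"
      using monomial_order_min[OF r finF] uw(1) by (auto simp: F_def)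
    then have w: "w \<in> F" "\<And>v. v \<in> F \<Longrightarrow> (v, w) \<in> r \<Longrightarrow> v = w"
      using monomial_order_antisym[OF r] by blast+
    have "(u0, w) \<in> quad_move\<^sup>*" "(w0, w) \<in> quad_move\<^sup>*"
      using down[OF _ w] uw by (auto simp: F_def)
    moreover have "(w, w0) \<in> quad_move\<^sup>*"
      using \<open>(w0, w) \<in> quad_move\<^sup>*\<close> sym_rtrancl[OF sym_quad_move] by (meson symD)
    ultimately show "(u0, w0) \<in> quad_move\<^sup>*" by simp
  qed
qed

text \<open>Within each fibre the coefficients of a member of the ideal sum to zero, so its initial
  monomial shares its fibre with a smaller term. It therefore suffices to reduce the greater
  monomial of a binomial.\<close>

lemma groebner_criterion:
  assumes r: "monomial_order V r"
    and reduce: "\<And>u w. u \<in> monomials V \<Longrightarrow> w \<in> monomials V \<Longrightarrow> multidegree u = multidegree w \<Longrightarrow>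
      u \<noteq> w \<Longrightarrow> (w, u) \<in> r \<Longrightarrow> \<exists>s t c. u = s + c \<and> s \<in> monomials V \<and> t \<in> monomials V \<and>
        mono_degree s = 2 \<and> multidegree s = multidegree t \<and> s \<noteq> t \<and> (t, s) \<in> r"
  shows "has_quadratic_groebner_basis V (toric_ideal P V rho :: ('a multiset, 'k::field) mpoly set)"
  unfolding has_quadratic_groebner_basis_def
proof (intro exI conjI ballI)
  let ?I = "toric_ideal P V rho :: ('a multiset, 'k) mpoly set"
  let ?in = "\<lambda>g :: ('a multiset, 'k) mpoly. mono_poly (initial_monomial r g) :: ('a multiset, 'k) mpoly"
  define G where "G = {g \<in> ?I. quadratic_binomial g}"
  show "monomial_order V r" by (rule r)
  show "quadratic_binomial g" if "g \<in> G" for g using that by (simp add: G_def)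
  have "G \<subseteq> (\<lambda>(s, t). mono_poly s - mono_poly t) `
    ({s \<in> monomials V. mono_degree s = 2} \<times> {s \<in> monomials V. mono_degree s = 2})"
  proof
    fix g assume "g \<in> G"
    then obtain s t where st: "g = mono_poly s - mono_poly t" "s \<in> monomials V" "t \<in> monomials V"
      "mono_degree s = 2" "multidegree s = multidegree t"
      using quadratic_binomial_in_toric unfolding G_def by (metis (no_types, lifting) mem_Collect_eq)
    then show "g \<in> (\<lambda>(s, t). mono_poly s - mono_poly t) `
      ({s \<in> monomials V. mono_degree s = 2} \<times> {s \<in> monomials V. mono_degree s = 2})"
      using same_degree[OF st(2,3,5)] by (intro image_eqI[of _ _ "(s, t)"]) auto
  qed
  then have "finite G"
    by (rule finite_subset) (intro finite_imageI finite_cartesian_product finite_monomials_degree fin_V)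
  moreover have "0 \<notin> G" by (auto simp: G_def quadratic_binomial_def total_degree_def)
  then have GI: "G \<subseteq> ?I - {0}" by (auto simp: G_def)
  moreover have "initial_ideal V r ?I = ideal_generated V (?in ` G)"
    unfolding initial_ideal_def
  proof
    show "ideal_generated V (?in ` G) \<subseteq> ideal_generated V (?in ` (?I - {0}))"
      using GI by (intro ideal_generated_mono) blast
    show "ideal_generated V (?in ` (?I - {0})) \<subseteq> ideal_generated V (?in ` G)"
    proof (rule ideal_generated_least, rule subsetI, elim imageE)
      fix m f assume f: "f \<in> ?I - {0}" and m: "m = ?in f"
      let ?u = "initial_monomial r f"
      have fV: "f \<in> polys V" using f toric_subset_polys by blast
      have init: "?u \<in> keys f" "\<And>w. w \<in> keys f \<Longrightarrow> (w, ?u) \<in> r"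
        using initial_monomial_properties[OF r fV] f by auto
      have "\<exists>w\<in>keys f. w \<noteq> ?u \<and> multidegree w = multidegree ?u"
      proof (rule ccontr)
        assume "\<not> ?thesis"
        then have "(\<Sum>m\<in>keys f. if multidegree m = multidegree ?u then lookup f m else 0) =
          (\<Sum>m\<in>keys f. if m = ?u then lookup f m else 0)"
          by (intro sum.cong) auto
        also have "\<dots> = lookup f ?u" using init(1) by simp
        finally have "lookup f ?u = 0"
          using toric_coeff_sum[of f "multidegree ?u"] f by (simp add: coeff_sum_def)
        then show False using init(1) by (simp add: in_keys_iff)
      qed
      then obtain w where w: "w \<in> keys f" "w \<noteq> ?u" "multidegree w = multidegree ?u" by blast
      have "?u \<in> monomials V" "w \<in> monomials V" using fV init(1) w(1) by (auto simp: polys_def)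
      then obtain s t c where st: "?u = s + c" "s \<in> monomials V" "t \<in> monomials V"
        "mono_degree s = 2" "multidegree s = multidegree t" "s \<noteq> t" "(t, s) \<in> r"
        using reduce[of ?u w] w init(2) by metis
      have "mono_poly s - mono_poly t \<in> G"
        unfolding G_def using st quadratic_binomial_iff binomial_in_toric by blast
      moreover have "initial_monomial r (mono_poly s - mono_poly t :: ('a multiset, 'k) mpoly) = s"
        using initial_monomial_binomial[OF r st(2,3,6,7)] .
      ultimately have "mono_poly s \<in> ?in ` G" by force
      moreover have "c \<in> monomials V" using \<open>?u \<in> monomials V\<close> st(1) by simp
      ultimately have "mono_poly c * mono_poly s \<in> ideal_generated V (?in ` G)"
        by (intro ideal_generated_base) auto
      then show "m \<in> ideal_generated V (?in ` G)"
        unfolding m st(1) by (simp add: mono_poly_add mult.commute)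
    qed
  qed
  ultimately show "groebner_basis V r ?I G" by (simp add: groebner_basis_def)
qed

end

section \<open>Rigid monomials on induced cycles\<close>

lemma sorted_wrt_comparable:
  "sorted_wrt (\<le>) xs \<Longrightarrow> x \<in> set xs \<Longrightarrow> y \<in> set xs \<Longrightarrow> comparable (\<le>) x (y :: 'a::order)"
  by (induction xs) (auto simp: comparable_def)

lemma comparable_imp_sorted_list:
  fixes C :: "'a::order multiset"
  assumes "\<And>x y. x \<in># C \<Longrightarrow> y \<in># C \<Longrightarrow> comparable (\<le>) x y"
  shows "\<exists>xs. mset xs = C \<and> sorted_wrt (\<le>) xs"
  using assms
proof (induction "size C" arbitrary: C)
  case 0
  then show ?case by (intro exI[of _ "[]"]) simp
next
  case (Suc n)
  then have "set_mset C \<noteq> {}" by auto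
  then obtain m where m: "m \<in># C" "\<And>b. b \<in># C \<Longrightarrow> b \<le> m \<Longrightarrow> m = b"
    using finite_has_minimal[of "set_mset C"] by auto
  then have le: "m \<le> b" if "b \<in># C" for b
    using Suc.prems[OF m(1) that] that by (auto simp: comparable_def)
  obtain C' where C: "C = add_mset m C'" using m(1) by (metis insert_DiffM)
  obtain xs where "mset xs = C'" "sorted_wrt (\<le>) xs"
    using Suc.hyps(1)[of C'] Suc.hyps(2) Suc.prems C by auto
  then show ?case using C le by (intro exI[of _ "m # xs"]) auto
qed

text \<open>Pairwise comparability replaces the sorted list, so that multichains become multisets
  supported on cliques of the comparability graph.\<close>

lemma multichains_iff:
  "C \<in> multichains d P \<longleftrightarrow> size C = d \<and> set_mset C \<subseteq> P \<and>
     (\<forall>x\<in>#C. \<forall>y\<in>#C. comparable (\<le>) x y)"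
proof
  assume "C \<in> multichains d P"
  then show "size C = d \<and> set_mset C \<subseteq> P \<and> (\<forall>x\<in>#C. \<forall>y\<in>#C. comparable (\<le>) x y)"
    unfolding multichains_def using sorted_wrt_comparable by fastforce
next
  assume C: "size C = d \<and> set_mset C \<subseteq> P \<and> (\<forall>x\<in>#C. \<forall>y\<in>#C. comparable (\<le>) x y)"
  then obtain xs where "mset xs = C" "sorted_wrt (\<le>) xs" using comparable_imp_sorted_list[of C] by auto
  then show "C \<in> multichains d P" using C unfolding multichains_def by auto
qed

lemma finite_multichains:
  assumes "finite P" shows "finite (multichains d P)"
proof -
  have "multichains d P \<subseteq> mset ` {xs. set xs \<subseteq> P \<and> length xs = d}"
    by (auto simp: multichains_def)
  then show ?thesis using finite_lists_length_eq[OF assms] finite_surj by blast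
qed

lemma multiset_configuration_multichains:
  assumes "finite P" "d > 0" shows "multiset_configuration P (multichains d P) d"
  by standard (use assms finite_multichains in \<open>auto simp: multichains_iff\<close>)

text \<open>The monomial of \<open>A\<close> is isolated under quadratic moves.\<close>

lemma (in multiset_configuration) rigid_imp_not_connected:
  assumes A: "A \<subseteq> V" and B: "B \<subseteq> V" and sum: "\<Sum>A = \<Sum>B" and neq: "A \<noteq> B"
    and rigid: "\<And>C D C' D'. C \<in> A \<Longrightarrow> D \<in> A \<Longrightarrow> C \<noteq> D \<Longrightarrow> C' \<in> V \<Longrightarrow> D' \<in> V \<Longrightarrow>
      C' + D' = C + D \<Longrightarrow> C' = C \<and> D' = D \<or> C' = D \<and> D' = C"
  shows "\<not> fibers_connected"
proof
  assume conn: fibers_connected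
  define mon where "mon X = (\<Sum>C\<in>X. single C (1::nat))" for X :: "'a multiset set"
  have finA: "finite A" and finB: "finite B" using A B fin_V finite_subset by blast+
  have lk: "lookup (mon X) C = (if C \<in> X then 1 else 0)" if "finite X" for X C
    using that by (simp add: mon_def lookup_sum lookup_single when_def)
  have ky: "keys (mon X) = X" if "finite X" for X
    using lk[OF that] by (auto simp: in_keys_iff split: if_splits)
  have md: "multidegree (mon X) = \<Sum>X" if "finite X" for X
    unfolding multidegree_def ky[OF that] by (intro sum.cong) (auto simp: lk[OF that])
  have V: "mon A \<in> monomials V" "mon B \<in> monomials V"
    using A B ky finA finB by (auto simp: monomials_def)
  have isolated: "w = mon A" if mv: "(mon A, w) \<in> quad_move" for w
  proof -
    obtain s t c where st: "mon A = s + c" "w = t + c" "s \<in> monomials V" "t \<in> monomials V"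
      "mono_degree s = 2" "multidegree s = multidegree t"
      using mv unfolding quad_move_def by blast
    obtain C D where s: "s = single C 1 + single D 1" using mono_degree_2[OF st(5)] by blast
    have "mono_degree t = 2" using same_degree[OF st(3,4,6)] st(5) by simp
    then obtain C' D' where t: "t = single C' 1 + single D' 1" using mono_degree_2 by blast
    have "lookup (mon A) C = lookup (single C 1 + single D 1) C + lookup c C"
      "lookup (mon A) D = lookup (single C 1 + single D 1) D + lookup c D"
      using st(1) s by (simp_all add: lookup_add)
    \<comment> \<open>The exponents of \<open>mon A\<close> are at most one, so \<open>C\<close> and
      \<open>D\<close> are distinct members of \<open>A\<close>.\<close>
    then have "C \<in> A" "D \<in> A" "C \<noteq> D"
      by (auto simp: lk[OF finA] lookup_add lookup_single split: if_splits)
    moreover have "C' \<in> V" "D' \<in> V" using st(4) t by auto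
    moreover have "C' + D' = C + D" using st(6) s t by (simp add: multidegree_add)
    ultimately have "C' = C \<and> D' = D \<or> C' = D \<and> D' = C" using rigid by blast
    then show ?thesis using st s t by (auto simp: add.commute)
  qed
  have "(mon A, mon B) \<in> quad_move\<^sup>*"
    using conn V md finA finB sum unfolding fibers_connected_def by auto
  then have "mon B = mon A"
    by (induction rule: rtrancl_induct) (use isolated in auto)
  then show False using ky finA finB neq by metis
qed

section \<open>Unique splitting of sums of two multichains\<close>

lemma multiset_eq_add_replicate:
  assumes "b \<in># M" "size M = d" "set_mset M \<subseteq> {b, c}" "count M b = 1"
  shows "M = add_mset b (replicate_mset (d - 1) c)"
proof -
  obtain X where X: "M = add_mset b X" using assms(1) by (metis insert_DiffM)
  have "b \<notin># X" using assms(4) X by (simp add: not_in_iff)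
  then have "set_mset X \<subseteq> {c}" using assms(3) X by auto
  then have "X = replicate_mset (size X) c" by (rule set_mset_subset_singletonD)
  moreover have "size X = d - 1" using assms(2) X by auto
  ultimately show ?thesis using X by simp
qed

lemma multiset_count_sum_eq_1:
  assumes "C' + D' = M" "count M a = 1" "a \<in># C'"
  shows "count C' a = 1"
proof -
  have "count C' a + count D' a = 1" using assms by (metis count_union)
  moreover have "count C' a \<ge> 1" using assms(3) by (simp add: Suc_le_eq)
  ultimately show ?thesis by linarith
qed

text \<open>Copies of \<open>p\<close> cannot share a multichain with \<open>q\<close>, so all of
  them lie in the multichain without \<open>q\<close>, and they fill it.\<close>

lemma rigid_power:
  assumes C': "C' \<in> multichains d P" and D': "D' \<in> multichains d P" and "d > 0"
    and eq: "C' + D' = replicate_mset d p + D" and q: "q \<in># D" "\<not> comparable (\<le>) p q"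
  shows "C' = replicate_mset d p \<and> D' = D \<or> C' = D \<and> D' = replicate_mset d p"
proof -
  have main: "C' = replicate_mset d p \<and> D' = D"
    if C': "C' \<in> multichains d P" and D': "D' \<in> multichains d P"
      and eq: "C' + D' = replicate_mset d p + D" and p: "p \<in># C'" for C' D'
  proof -
    have "q \<notin># C'" using C' p q(2) by (auto simp: multichains_iff)
    moreover have "q \<in># C' + D'" using eq q(1) by simp
    ultimately have "q \<in># D'" by simp
    then have "p \<notin># D'" using D' q(2) by (auto simp: multichains_iff)
    then have "count C' p \<ge> d" using arg_cong[OF eq, of "\<lambda>M. count M p"] by (simp add: not_in_iff)
    then have "replicate_mset d p \<subseteq># C'" by (simp add: count_le_replicate_mset_subset_eq[symmetric])
    then obtain X where X: "C' = replicate_mset d p + X" by (metis subset_mset.le_iff_add)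
    then have "size X = 0" using C' by (simp add: multichains_iff)
    then show ?thesis using X eq by simp
  qed
  have "p \<in># C' + D'" using eq \<open>d > 0\<close> by simp
  then consider "p \<in># C'" | "p \<in># D'" by auto
  then show ?thesis
  proof cases
    case 1
    then show ?thesis using main[OF C' D' eq] by blast
  next
    case 2
    then show ?thesis using main[OF D' C'] eq by (simp add: add.commute)
  qed
qed

text \<open>The multichain that contains the single \<open>b\<close> avoids \<open>e\<close>, so
  \<open>c\<close> has to fill its remaining \<open>d - 1\<close> places.\<close>

lemma rigid_chained:
  assumes C': "C' \<in> multichains d P" and D': "D' \<in> multichains d P" and "d \<ge> 2"
    and eq: "C' + D' = add_mset b (replicate_mset (d - 1) c) + add_mset c (replicate_mset (d - 1) e)"
    and dist: "b \<noteq> c" "b \<noteq> e" and be: "\<not> comparable (\<le>) b e"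
  shows "C' = add_mset b (replicate_mset (d - 1) c) \<and> D' = add_mset c (replicate_mset (d - 1) e) \<or>
    C' = add_mset c (replicate_mset (d - 1) e) \<and> D' = add_mset b (replicate_mset (d - 1) c)"
proof -
  let ?C = "add_mset b (replicate_mset (d - 1) c)" and ?D = "add_mset c (replicate_mset (d - 1) e)"
  have main: "C' = ?C \<and> D' = ?D"
    if C': "C' \<in> multichains d P" and eq: "C' + D' = ?C + ?D" and b: "b \<in># C'" for C' D'
  proof -
    have sub: "set_mset C' \<subseteq> {b, c, e}"
      using arg_cong[OF eq, of set_mset] by (auto split: if_splits)
    have "e \<notin># C'" using C' b be by (auto simp: multichains_iff)
    then have "set_mset C' \<subseteq> {b, c}" using sub by blast
    moreover have "count C' b = 1"
      using multiset_count_sum_eq_1[OF eq _ b] dist by simp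
    ultimately have "C' = ?C" using multiset_eq_add_replicate[OF b] C' by (simp add: multichains_iff)
    then show ?thesis using eq by simp
  qed
  have "b \<in># C' + D'" using eq by simp
  then consider "b \<in># C'" | "b \<in># D'" by auto
  then show ?thesis
  proof cases
    case 1
    then show ?thesis using main[OF C' eq] by blast
  next
    case 2
    then show ?thesis using main[OF D', of C'] eq by (simp add: add.commute)
  qed
qed

text \<open>\<open>a\<close> cannot join \<open>c\<close>, nor \<open>b\<close> join
  \<open>e\<close>; the only other distribution pairs \<open>a\<close> with \<open>e\<close> and
  \<open>c\<close> with \<open>b\<close>, which \<open>cross\<close> forbids.\<close>

lemma rigid_matching:
  assumes C': "C' \<in> multichains d P" and D': "D' \<in> multichains d P" and "d \<ge> 2"
    and eq: "C' + D' = add_mset a (replicate_mset (d - 1) b) + add_mset c (replicate_mset (d - 1) e)"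
    and dist: "a \<noteq> b" "a \<noteq> e"
    and ac: "\<not> comparable (\<le>) a c" and be: "\<not> comparable (\<le>) b e"
    and cross: "\<not> (comparable (\<le>) a e \<and> comparable (\<le>) c b)"
  shows "C' = add_mset a (replicate_mset (d - 1) b) \<and> D' = add_mset c (replicate_mset (d - 1) e) \<or>
    C' = add_mset c (replicate_mset (d - 1) e) \<and> D' = add_mset a (replicate_mset (d - 1) b)"
proof -
  let ?C = "add_mset a (replicate_mset (d - 1) b)" and ?D = "add_mset c (replicate_mset (d - 1) e)"
  have main: "C' = ?C \<and> D' = ?D"
    if C': "C' \<in> multichains d P" and D': "D' \<in> multichains d P"
      and eq: "C' + D' = ?C + ?D" and a: "a \<in># C'" for C' D'
  proof -
    have mem: "x \<in># C' \<or> x \<in># D' \<longleftrightarrow> x \<in> {a, b, c, e}" for x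
      using arg_cong[OF eq, of set_mset] \<open>d \<ge> 2\<close> by (auto split: if_splits)
    have cC: "c \<notin># C'" using C' a ac by (auto simp: multichains_iff)
    then have cD: "c \<in># D'" using mem by blast
    have "e \<notin># C'"
    proof
      assume e: "e \<in># C'"
      then have "comparable (\<le>) a e" using C' a by (auto simp: multichains_iff)
      moreover have "b \<notin># C'" using C' e be by (auto simp: multichains_iff)
      then have "b \<in># D'" using mem by blast
      then have "comparable (\<le>) c b" using D' cD by (auto simp: multichains_iff)
      ultimately show False using cross by blast
    qed
    then have "set_mset C' \<subseteq> {a, b}" using mem cC by blast
    moreover have "a \<noteq> c" using ac by (auto simp: comparable_def)
    then have "count C' a = 1"
      using multiset_count_sum_eq_1[OF eq _ a] dist by simp
    ultimately have "C' = ?C" using multiset_eq_add_replicate[OF a] C' by (simp add: multichains_iff)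
    then show ?thesis using eq by simp
  qed
  have "a \<in># C' + D'" using eq by simp
  then consider "a \<in># C'" | "a \<in># D'" by auto
  then show ?thesis
  proof cases
    case 1
    then show ?thesis using main[OF C' D' eq] by blast
  next
    case 2
    then show ?thesis using main[OF D' C'] eq by (simp add: add.commute)
  qed
qed

lemma add_replicate_in_multichains:
  assumes "x \<in> P" "y \<in> P" "comparable (\<le>) x y" "d > 0"
  shows "add_mset x (replicate_mset (d - 1) y) \<in> multichains d P"
  using assms by (auto simp: multichains_iff comparable_def split: if_splits)

text \<open>In a four-cycle opposite edges can trade end points, so the monomials of two matchings
  are not rigid. Instead three multichains share the multidegree a^d b c^d e^(d-1), and the second
  monomial arises from the first by interchanging \<open>a\<close> and \<open>c\<close>.\<close>

lemma C4_not_connected: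
  fixes P :: "'a::order set"
  assumes "finite P" "d \<ge> 2" and P: "a \<in> P" "b \<in> P" "c \<in> P" "e \<in> P"
    and dist: "distinct [a, b, c, e]"
    and R: "comparable (\<le>) a b" "comparable (\<le>) b c" "comparable (\<le>) c e" "comparable (\<le>) e a"
    and nR: "\<not> comparable (\<le>) a c" "\<not> comparable (\<le>) b e"
  shows "\<not> multiset_configuration.fibers_connected (multichains d P)"
proof -
  interpret multiset_configuration P "multichains d P" d
    using multiset_configuration_multichains[of P d] assms(1,2) by simp
  let ?A1 = "replicate_mset d a" and ?A2 = "add_mset b (replicate_mset (d - 1) c)"
    and ?A3 = "add_mset c (replicate_mset (d - 1) e)"
  let ?B1 = "replicate_mset d c" and ?B2 = "add_mset b (replicate_mset (d - 1) a)"
    and ?B3 = "add_mset a (replicate_mset (d - 1) e)"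
  have d: "d > 0" "d - 1 > 0" using assms(2) by auto
  have Rs: "comparable (\<le>) y x" if "comparable (\<le>) x y" for x y :: 'a
    using that by (auto simp: comparable_def)
  have A: "{?A1, ?A2, ?A3} \<subseteq> multichains d P" and B: "{?B1, ?B2, ?B3} \<subseteq> multichains d P"
    using add_replicate_in_multichains[of _ P _ d] P R Rs d
    by (auto simp: multichains_iff[of "replicate_mset _ _"] comparable_def split: if_splits)
  have set: "set_mset ?A1 = {a}" "set_mset ?A2 = {b, c}" "set_mset ?A3 = {c, e}"
    "set_mset ?B1 = {c}" "set_mset ?B2 = {a, b}" "set_mset ?B3 = {a, e}"
    using d by auto
  have distA: "?A1 \<noteq> ?A2" "?A1 \<noteq> ?A3" "?A2 \<noteq> ?A3" and distB: "?B1 \<noteq> ?B2" "?B1 \<noteq> ?B3" "?B2 \<noteq> ?B3"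
    and AB: "?A1 \<notin> {?B1, ?B2, ?B3}"
    using dist set by (metis distinct_length_2_or_more doubleton_eq_iff insert_iff empty_iff)+
  show ?thesis
  proof (rule rigid_imp_not_connected[OF A B])
    have "replicate_mset d x = add_mset x (replicate_mset (d - 1) x)" for x :: 'a
      using d by (metis Suc_diff_1 replicate_mset_Suc)
    then show "\<Sum>{?A1, ?A2, ?A3} = \<Sum>{?B1, ?B2, ?B3}"
      using distA distB by (simp add: ac_simps)
    show "{?A1, ?A2, ?A3} \<noteq> {?B1, ?B2, ?B3}" using AB by blast
    fix C D C' D'
    assume C: "C \<in> {?A1, ?A2, ?A3}" and D: "D \<in> {?A1, ?A2, ?A3}" and "C \<noteq> D"
      and C': "C' \<in> multichains d P" and D': "D' \<in> multichains d P" and eq: "C' + D' = C + D"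
    have 1: "C' = ?A1 \<and> D' = X \<or> C' = X \<and> D' = ?A1" if "C' + D' = ?A1 + X" "X = ?A2 \<or> X = ?A3" for X
      using rigid_power[OF C' D' d(1) that(1), of c] that(2) nR(1) d by auto
    have 2: "C' = ?A2 \<and> D' = ?A3 \<or> C' = ?A3 \<and> D' = ?A2" if "C' + D' = ?A2 + ?A3"
      using rigid_chained[OF C' D' assms(2) that] dist nR(2) by auto
    show "C' = C \<and> D' = D \<or> C' = D \<and> D' = C"
      using C D \<open>C \<noteq> D\<close> eq 1[of ?A2] 1[of ?A3] 2 by (elim insertE emptyE) (simp_all add: add.commute, blast+)
  qed
qed

lemma sum_rotate:
  fixes g :: "nat \<Rightarrow> 'b::comm_monoid_add"
  assumes "m > 0"
  shows "(\<Sum>i<m. g (Suc i mod m)) = (\<Sum>i<m. g i)"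
proof -
  obtain k where m: "m = Suc k" using assms gr0_conv_Suc by blast
  have "(\<Sum>i<k. g (Suc i mod m)) = (\<Sum>i<k. g (Suc i))" by (intro sum.cong) (auto simp: m)
  then have "(\<Sum>i<Suc k. g (Suc i mod m)) = (\<Sum>i<k. g (Suc i)) + g 0" by (simp add: m)
  also have "\<dots> = (\<Sum>i<Suc k. g i)" by (simp only: sum.lessThan_Suc_shift add.commute)
  finally show ?thesis by (simp only: m)
qed

text \<open>The two perfect matchings of a cycle of length 2m give the two monomials, with weight 1
  at each \<open>a i\<close> and \<open>d - 1\<close> at each \<open>b i\<close>. Two edges of one
  matching could trade end points only within a four-cycle, which \<open>m \<ge> 3\<close>
  prevents.\<close>

lemma even_cycle_not_connected:
  fixes P :: "'a::order set" and a b :: "nat \<Rightarrow> 'a"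
  assumes "finite P" "d \<ge> 2" "m \<ge> 3"
    and P: "\<And>i. i < m \<Longrightarrow> a i \<in> P" "\<And>i. i < m \<Longrightarrow> b i \<in> P"
    and aa: "\<And>i j. i < m \<Longrightarrow> j < m \<Longrightarrow> i \<noteq> j \<Longrightarrow> \<not> comparable (\<le>) (a i) (a j)"
    and bb: "\<And>i j. i < m \<Longrightarrow> j < m \<Longrightarrow> i \<noteq> j \<Longrightarrow> \<not> comparable (\<le>) (b i) (b j)"
    and neq: "\<And>i j. i < m \<Longrightarrow> j < m \<Longrightarrow> a i \<noteq> b j"
    and ab: "\<And>i j. i < m \<Longrightarrow> j < m \<Longrightarrow> comparable (\<le>) (a i) (b j) \<longleftrightarrow> i = j \<or> i = Suc j mod m"
  shows "\<not> multiset_configuration.fibers_connected (multichains d P)"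
proof -
  interpret multiset_configuration P "multichains d P" d
    using multiset_configuration_multichains[of P d] assms(1,2) by simp
  have d: "d > 0" "d - 1 > 0" using assms(2) by auto
  have lt: "Suc i mod m < m" for i using assms(3) by simp
  have step: "Suc k mod m = (if Suc k = m then 0 else Suc k)" if "k < m" for k using that by auto
  define f g where "f i = add_mset (a i) (replicate_mset (d - 1) (b i))"
    and "g i = add_mset (a (Suc i mod m)) (replicate_mset (d - 1) (b i))" for i
  have inj_b: "i = j" if "i < m" "j < m" "b i = b j" for i j
    using bb[of i j] that by (auto simp: comparable_def)
  have inj_a: "i = j" if "i < m" "j < m" "a i = a j" for i j
    using aa[of i j] that by (auto simp: comparable_def)
  have set: "set_mset (f i) = {a i, b i}" "set_mset (g i) = {a (Suc i mod m), b i}" for i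
    using d by (auto simp: f_def g_def)
  have inj_f: "inj_on f {..<m}" and inj_g: "inj_on g {..<m}"
    using set neq inj_b lt unfolding inj_on_def by (metis doubleton_eq_iff lessThan_iff)+
  show ?thesis
  proof (rule rigid_imp_not_connected)
    show "f ` {..<m} \<subseteq> multichains d P" "g ` {..<m} \<subseteq> multichains d P"
      using P ab lt by (auto simp: f_def g_def intro!: add_replicate_in_multichains[OF _ _ _ d(1), simplified])
    have "\<Sum>(f ` {..<m}) = (\<Sum>i<m. {#a i#}) + (\<Sum>i<m. replicate_mset (d - 1) (b i))"
      unfolding sum.reindex[OF inj_f] sum.distrib[symmetric] by (simp add: f_def)
    also have "(\<Sum>i<m. {#a i#}) = (\<Sum>i<m. {#a (Suc i mod m)#})"
      using sum_rotate[of m "\<lambda>i. {#a i#}"] assms(3) by simp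
    also have "\<dots> + (\<Sum>i<m. replicate_mset (d - 1) (b i)) = \<Sum>(g ` {..<m})"
      unfolding sum.reindex[OF inj_g] sum.distrib[symmetric] by (simp add: g_def)
    finally show "\<Sum>(f ` {..<m}) = \<Sum>(g ` {..<m})" .
    have "f 0 \<notin> g ` {..<m}"
    proof
      assume "f 0 \<in> g ` {..<m}"
      then obtain j where j: "j < m" "f 0 = g j" by blast
      then have *: "{a 0, b 0} = {a (Suc j mod m), b j}" using set by metis
      have m0: "0 < m" using assms(3) by simp
      have "b 0 = b j" using * neq[OF m0 j(1)] by (auto simp: doubleton_eq_iff)
      then have "j = 0" using inj_b[OF m0 j(1)] by simp
      then have "a 0 = a 1" using * neq[OF m0 j(1)] assms(3) by (auto simp: doubleton_eq_iff)
      then show False using inj_a[of 0 1] assms(3) by simp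
    qed
    moreover have "f 0 \<in> f ` {..<m}" using assms(3) by auto
    ultimately show "f ` {..<m} \<noteq> g ` {..<m}" by blast
    fix C D C' D'
    assume C: "C \<in> f ` {..<m}" and D: "D \<in> f ` {..<m}" and CD: "C \<noteq> D"
      and C': "C' \<in> multichains d P" and D': "D' \<in> multichains d P" and eq: "C' + D' = C + D"
    obtain i j where ij: "i < m" "j < m" "i \<noteq> j" and [simp]: "C = f i" "D = f j" using C D CD by blast
    \<comment> \<open>Both cross edges together would make \<open>i\<close> and \<open>j\<close>
      cyclic successors of each other, which forces \<open>m = 2\<close>.\<close>
    have cross: "\<not> (comparable (\<le>) (a i) (b j) \<and> comparable (\<le>) (a j) (b i))"
    proof
      assume "comparable (\<le>) (a i) (b j) \<and> comparable (\<le>) (a j) (b i)"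
      then have e: "i = Suc j mod m" "j = Suc i mod m" using iffD1[OF ab[OF ij(1,2)]] iffD1[OF ab[OF ij(2,1)]] ij(3) not_sym[OF ij(3)] by blast+
      have "i = 0 \<and> Suc j = m \<or> i = Suc j"
        using trans[OF e(1) step[OF ij(2)]] by (cases "Suc j = m") simp_all
      moreover have "j = 0 \<and> Suc i = m \<or> j = Suc i"
        using trans[OF e(2) step[OF ij(1)]] by (cases "Suc i = m") simp_all
      ultimately show False using assms(3) by arith
    qed
    show "C' = C \<and> D' = D \<or> C' = D \<and> D' = C"
      using rigid_matching[OF C' D' assms(2) eq[unfolded \<open>C = f i\<close> \<open>D = f j\<close> f_def]
          neq[OF ij(1,1)] neq[OF ij(1,2)] aa[OF ij] bb[OF ij] cross]
      by (simp add: f_def)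
  qed
qed

lemma not_chordal_imp_not_connected:
  fixes P :: "'a::order set"
  assumes "finite P" "d \<ge> 2" and not_chordal: "\<not> chordal P (comparability_edges P)"
  shows "\<not> multiset_configuration.fibers_connected (multichains d P)"
proof -
  obtain xs where cyc: "induced_cycle P (comparability_edges P) xs" "length xs \<noteq> 3"
    using not_chordal unfolding chordal_def by blast
  define n where "n = length xs"
  define y where "y i = xs ! (i mod n)" for i
  have n: "n \<ge> 4" and dist: "distinct xs" and sub: "set xs \<subseteq> P"
    using cyc by (auto simp: induced_cycle_def n_def)
  have "n > 0" using n by simp
  then have lt: "i mod n < length xs" for i unfolding n_def by (rule mod_less_divisor)
  then have yP: "y i \<in> P" for i using sub nth_mem unfolding y_def by blast
  have y_eq: "y i = y j \<longleftrightarrow> i mod n = j mod n" for i j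
    using dist lt by (simp add: y_def nth_eq_iff_index_eq)
  have adj: "comparable (\<le>) (y i) (y j) \<longleftrightarrow>
      i mod n = j mod n \<or> j mod n = Suc i mod n \<or> i mod n = Suc j mod n" for i j
  proof -
    have "{y i, y j} \<in> comparability_edges P \<longleftrightarrow> j mod n = Suc i mod n \<or> i mod n = Suc j mod n"
      using cyc(1) lt unfolding induced_cycle_def y_def n_def[symmetric] by (simp add: mod_Suc_eq)
    then show ?thesis
      using yP y_eq[of i j] by (auto simp: comparability_edge_iff comparable_def)
  qed
  define up where "up i \<longleftrightarrow> y i < y (Suc i)" for i
  have alt: "up (Suc i) \<longleftrightarrow> \<not> up i" for i
  proof -
    \<comment> \<open>\<open>n \<ge> 4\<close> keeps \<open>y i\<close> and \<open>y (i + 2)\<close>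
      distinct and nonadjacent; two steps in the same direction would make them comparable.\<close>
    have ne: "i mod n \<noteq> Suc i mod n" "i mod n \<noteq> Suc (Suc i) mod n" "i mod n \<noteq> Suc (Suc (Suc i)) mod n"
      "Suc (Suc i) mod n \<noteq> Suc i mod n" for i
      using n by (auto simp: mod_Suc split: if_splits)
    have "comparable (\<le>) (y i) (y (Suc i))" "comparable (\<le>) (y (Suc i)) (y (Suc (Suc i)))"
      using adj by auto
    moreover have "\<not> comparable (\<le>) (y i) (y (Suc (Suc i)))" using adj ne by metis
    moreover have "y i \<noteq> y (Suc i)" "y (Suc i) \<noteq> y (Suc (Suc i))" using y_eq ne by auto
    ultimately show ?thesis unfolding up_def comparable_def by (metis less_le order_trans dual_order.asym)
  qed
  have "up i \<longleftrightarrow> (up 0 \<longleftrightarrow> even i)" for i by (induction i) (auto simp: alt)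
  moreover have "up n \<longleftrightarrow> up 0" by (simp add: up_def y_def mod_Suc)
  ultimately have "even n" by blast
  then obtain m where m: "n = 2 * m" by blast
  show ?thesis
  proof (cases "m = 2")
    case True
    then have [simp]: "n = 4" using m by simp
    show ?thesis
    proof (rule C4_not_connected[OF assms(1,2), of "y 0" "y 1" "y 2" "y 3"])
      show "distinct [y 0, y 1, y 2, y 3]" by (simp add: y_eq)
    qed (use yP adj in auto)
  next
    case False
    show ?thesis
    proof (rule even_cycle_not_connected[OF assms(1,2), of m "\<lambda>i. y (2 * i)" "\<lambda>i. y (Suc (2 * i))"])
      show "m \<ge> 3" using False n m by simp
      fix i j assume ij: "i < m" "j < m"
      have mods: "(2 * k) mod n = 2 * k" "Suc (2 * k) mod n = Suc (2 * k)"
        "Suc (Suc (2 * k)) mod n = (if Suc k = m then 0 else 2 * Suc k)" if "k < m" for k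
        using that m by auto
      note mods = mods[OF ij(1)] mods[OF ij(2)]
      have step: "Suc j mod m = (if Suc j = m then 0 else Suc j)" using ij by auto
      show "y (2 * i) \<noteq> y (Suc (2 * j))" unfolding y_eq mods by presburger
      show "comparable (\<le>) (y (2 * i)) (y (Suc (2 * j))) \<longleftrightarrow> i = j \<or> i = Suc j mod m"
        unfolding adj mods step by (cases "Suc j = m"; simp; presburger)
      assume "i \<noteq> j"
      then show "\<not> comparable (\<le>) (y (2 * i)) (y (2 * j))"
        "\<not> comparable (\<le>) (y (Suc (2 * i))) (y (Suc (2 * j)))"
        unfolding adj mods by presburger+
    qed (use yP in auto)
  qed
qed

section \<open>The reverse lexicographic Groebner basis\<close>

text \<open>The variable with the greatest key is the smallest one.\<close>

definition degrevlex :: "'v set \<Rightarrow> ('v \<Rightarrow> 'o::linorder) \<Rightarrow> 'v monomial rel" where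
  "degrevlex V \<kappa> = {(u, w). u \<in> monomials V \<and> w \<in> monomials V \<and>
     (u = w \<or> mono_degree u < mono_degree w \<or> mono_degree u = mono_degree w \<and>
       (\<exists>v\<in>V. lookup w v < lookup u v \<and> (\<forall>v'\<in>V. \<kappa> v < \<kappa> v' \<longrightarrow> lookup u v' = lookup w v')))}"

text \<open>Injectivity of \<open>\<kappa>\<close> ranks the deciding variables of two comparisons,
  as transitivity and through it antisymmetry require; finiteness provides the greatest variable
  where two monomials differ.\<close>

lemma monomial_order_degrevlex:
  fixes \<kappa> :: "'v \<Rightarrow> 'o::linorder"
  assumes fin: "finite V" and inj: "inj_on \<kappa> V"
  shows "monomial_order V (degrevlex V \<kappa>)"
proof -
  let ?r = "degrevlex V \<kappa>"
  define lt where "lt u w \<longleftrightarrow> (\<exists>v\<in>V. lookup w v < lookup u v \<and>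
    (\<forall>v'\<in>V. \<kappa> v < \<kappa> v' \<longrightarrow> lookup u v' = lookup w v'))" for u w :: "'v monomial"
  have r: "(u, w) \<in> ?r \<longleftrightarrow> u \<in> monomials V \<and> w \<in> monomials V \<and>
     (u = w \<or> mono_degree u < mono_degree w \<or> mono_degree u = mono_degree w \<and> lt u w)" for u w
    by (simp add: degrevlex_def lt_def)
  have lt_trans: "lt u w" if uv: "lt u v" and vw: "lt v w" for u v w
  proof -
    obtain x where x: "x \<in> V" "lookup v x < lookup u x" "\<And>z. z \<in> V \<Longrightarrow> \<kappa> x < \<kappa> z \<Longrightarrow> lookup u z = lookup v z"
      using uv unfolding lt_def by blast
    obtain y where y: "y \<in> V" "lookup w y < lookup v y" "\<And>z. z \<in> V \<Longrightarrow> \<kappa> y < \<kappa> z \<Longrightarrow> lookup v z = lookup w z"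
      using vw unfolding lt_def by blast
    consider "\<kappa> x < \<kappa> y" | "\<kappa> y < \<kappa> x" | "x = y" using inj x(1) y(1) by (meson inj_onD linorder_neqE)
    then show ?thesis
    proof cases
      case 1
      then show ?thesis unfolding lt_def using x y by (intro bexI[of _ y]) auto
    next
      case 2
      then show ?thesis unfolding lt_def using x y by (intro bexI[of _ x]) auto
    next
      case 3
      then show ?thesis unfolding lt_def using x y by (intro bexI[of _ y]) auto
    qed
  qed
  have lt_asym: False if "lt u w" "lt w u" for u w
    using lt_trans[OF that] unfolding lt_def by auto
  have lt_total: "lt u w \<or> lt w u" if neq: "u \<noteq> w" and "u \<in> monomials V" "w \<in> monomials V" for u w
  proof -
    let ?D = "{v \<in> V. lookup u v \<noteq> lookup w v}"
    obtain v where "lookup u v \<noteq> lookup w v" using neq by (metis poly_mapping_eqI)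
    moreover have "v \<in> V" if "lookup u v \<noteq> lookup w v" for v
      using that \<open>u \<in> monomials V\<close> \<open>w \<in> monomials V\<close> unfolding monomials_def
      by (metis (mono_tags, lifting) in_keys_iff mem_Collect_eq subset_iff)
    ultimately have "\<kappa> ` ?D \<noteq> {}" by blast
    then have "Max (\<kappa> ` ?D) \<in> \<kappa> ` ?D" using fin by (intro Max_in) auto
    then obtain x where x: "x \<in> ?D" "\<kappa> x = Max (\<kappa> ` ?D)" by force
    have "lookup u z = lookup w z" if "z \<in> V" "\<kappa> x < \<kappa> z" for z
    proof (rule ccontr)
      assume "lookup u z \<noteq> lookup w z"
      then have "\<kappa> z \<le> \<kappa> x" unfolding x(2) using that fin by (intro Max_ge) auto
      then show False using that by simp
    qed
    then show ?thesis unfolding lt_def using x(1) by (auto simp: neq_iff)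
  qed
  show ?thesis
    unfolding monomial_order_def linear_order_on_def partial_order_on_def preorder_on_def
  proof (intro conjI ballI impI)
    show "?r \<subseteq> monomials V \<times> monomials V" by (auto simp: r)
    show "refl_on (monomials V) ?r" by (auto simp: refl_on_def r)
    show "trans ?r" using lt_trans by (auto simp: trans_def r)
    show "antisym ?r" using lt_asym by (auto simp: antisym_def r)
    show "total_on (monomials V) ?r" using lt_total by (auto simp: total_on_def r)
    show "(0, u) \<in> ?r" if "u \<in> monomials V" for u using that by (auto simp: r)
    show "(u + w, v + w) \<in> ?r"
      if "u \<in> monomials V" "v \<in> monomials V" "w \<in> monomials V" "(u, v) \<in> ?r" for u v w
      using that by (auto simp: r mono_degree_add lt_def lookup_add)
  qed
qed

lemma inj_on_image_mset_multichains:
  assumes "inj_on h P" shows "inj_on (image_mset h) (multichains d P)"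
proof (rule inj_onI)
  fix C D assume C: "C \<in> multichains d P" and D: "D \<in> multichains d P" and eq: "image_mset h C = image_mset h D"
  have "image_mset (inv_into P h) (image_mset h X) = X" if "X \<in> multichains d P" for X
  proof -
    have "image_mset (inv_into P h \<circ> h) X = image_mset id X"
      using that assms by (intro image_mset_cong) (auto simp: multichains_iff inv_into_f_f subset_iff)
    then show ?thesis by (simp add: multiset.map_comp)
  qed
  then show "C = D" using C D eq by metis
qed

text \<open>If \<open>A\<close> had more of some \<open>x\<close> and \<open>A'\<close> more of some
  \<open>y\<close>, then \<open>x\<close> would occur in \<open>B'\<close> and \<open>y\<close> in
  \<open>B\<close>; the two maximality conditions would give \<open>h x = h y\<close>.\<close>

lemma top_submultiset_unique:
  fixes h :: "'a \<Rightarrow> nat"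
  assumes eq: "A + B = A' + B'" and size: "size A = size A'"
    and inj: "inj_on h (set_mset (A + B))"
    and top: "\<And>x y. x \<in># A \<Longrightarrow> y \<in># B \<Longrightarrow> h y \<le> h x"
    and top': "\<And>x y. x \<in># A' \<Longrightarrow> y \<in># B' \<Longrightarrow> h y \<le> h x"
  shows "A = A'"
proof (rule ccontr)
  assume neq: "A \<noteq> A'"
  have cnt: "count A z + count B z = count A' z + count B' z" for z
    using arg_cong[OF eq, of "\<lambda>M. count M z"] by simp
  have sub: "X \<subseteq># Y \<Longrightarrow> size X = size Y \<Longrightarrow> X = Y" for X Y :: "'a multiset"
    by (metis mset_subset_size nless_le subset_mset.nless_le)
  obtain x where x: "count A' x < count A x"
    using sub[of A A'] size neq unfolding subseteq_mset_def by (meson not_le)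
  obtain y where y: "count A y < count A' y"
    using sub[of A' A] size neq unfolding subseteq_mset_def by (metis not_le)
  have "x \<in># A" "x \<in># B'" "y \<in># A'" "y \<in># B"
    using x y cnt[of x] cnt[of y] by (auto simp: count_greater_zero_iff[symmetric] simp del: count_greater_zero_iff)
  then have "h x = h y" using top[of x y] top'[of y x] by simp
  then have "x = y" using inj_onD[OF inj] \<open>x \<in># A\<close> \<open>y \<in># B\<close> by auto
  then show False using x y by simp
qed

section \<open>Exchanges between multichains and normal monomials\<close>

locale eliminable_poset =
  fixes P :: "'a::order set" and h :: "'a \<Rightarrow> nat" and d :: nat
  assumes fin_P: "finite P" and d: "d > 0"
    and elim: "strong_elimination (comparable (\<le>)) P h"
begin

abbreviation "R \<equiv> comparable ((\<le>) :: 'a \<Rightarrow> 'a \<Rightarrow> bool)"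
abbreviation "V \<equiv> multichains d P"
text \<open>Keys are compared in the multiset order, where the greatest values of \<open>h\<close>,
  belonging to the vertices eliminated first, decide first.\<close>

abbreviation "key \<equiv> image_mset h"

sublocale multiset_configuration P V d
  using fin_P d by (rule multiset_configuration_multichains)

lemma R_sym: "R x y \<Longrightarrow> R y x" and R_refl: "R x x"
  by (auto simp: comparable_def)

lemma inj_h: "inj_on h P" using elim by (simp add: strong_elimination_def)

lemma h_strong:
  assumes "i \<in> P" "j \<in> P" "k \<in> P" "l \<in> P" "h l < h k" "h k \<le> h j" "h j < h i" "R i k" "R i l" "R j k"
  shows "R j l"
  using elim assms unfolding strong_elimination_def by blast

lemma h_simplicial:
  assumes "i \<in> P" "k \<in> P" "l \<in> P" "h k \<le> h i" "h l \<le> h i" "R i k" "R i l"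
  shows "R k l"
proof -
  have main: "R k l" if "k \<in> P" "l \<in> P" "h k \<le> h i" "R i k" "R i l" "h l < h k" for k l
  proof (cases "k = i")
    case False
    then have "h k < h i" using that assms(1) inj_h by (metis inj_onD le_neq_implies_less)
    then show ?thesis using h_strong[of i k k l] that assms(1) R_refl by blast
  qed (use that in simp)
  consider "h l < h k" | "h k < h l" | "k = l" using inj_h assms by (meson inj_onD linorder_neqE)
  then show ?thesis
  proof cases
    case 1
    then show ?thesis using main[of k l] assms by blast
  next
    case 2
    then show ?thesis using main[of l k] assms R_sym by blast
  qed (simp add: R_refl)
qed

lemma key_le_imp:
  assumes "key D \<le> key C" "x \<in># D" shows "\<exists>y\<in>#C. h x \<le> h y"
proof (rule ccontr)
  assume "\<not> ?thesis"
  then have "key C < key D" using assms(2) by (intro ex_gt_imp_less_multiset) force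
  then show False using assms(1) by simp
qed

lemma key_less: "h e < h e' \<Longrightarrow> key (add_mset e X) < key (add_mset e' X)"
proof -
  assume "h e < h e'"
  then have "{#h e#} < {#h e'#}" by (intro ex_gt_imp_less_multiset) auto
  then have "key X + {#h e#} < key X + {#h e'#}" by (rule add_strict_left_mono)
  then show ?thesis by simp
qed

lemma max_element:
  assumes "C \<in> V" shows "\<exists>i\<in>#C. \<forall>x\<in>#C. h x \<le> h i"
proof -
  have "C \<noteq> {#}" using assms d by (auto simp: multichains_iff)
  then have "Max (h ` set_mset C) \<in> h ` set_mset C" by (intro Max_in) auto
  then obtain i where "i \<in># C" "h i = Max (h ` set_mset C)" by force
  then show ?thesis by (metis Max_ge finite_imageI finite_set_mset imageI)
qed

text \<open>\<open>e'\<close> fits into \<open>C\<close> because the neighbours of \<open>i\<close>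
  with smaller \<open>h\<close> form a clique. For \<open>e\<close>, strong elimination at
  \<open>i\<close> carries the adjacency of the top vertex \<open>j\<close> of \<open>D\<close> from
  \<open>e'\<close> over to \<open>e\<close>, and then the neighbours of \<open>j\<close> with
  smaller \<open>h\<close> form a clique.\<close>

lemma exchange:
  assumes C: "C \<in> V" and D: "D \<in> V" and key: "key D \<le> key C"
    and i: "i \<in># C" "\<And>x. x \<in># C \<Longrightarrow> h x \<le> h i"
    and e: "e \<in># C" "e' \<in># D" "R i e'" "h e < h e'"
  obtains C' D' where "C' \<in> V" "D' \<in> V" "C' + D' = C + D" "key C < key C'" "key D' < key D"
proof -
  obtain X where X: "C = add_mset e X" using e(1) by (metis insert_DiffM)
  obtain Y where Y: "D = add_mset e' Y" using e(2) by (metis insert_DiffM)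
  have CP: "\<And>x. x \<in># C \<Longrightarrow> x \<in> P" "\<And>x y. x \<in># C \<Longrightarrow> y \<in># C \<Longrightarrow> R x y" "size C = d"
    using C by (auto simp: multichains_iff)
  have DP: "\<And>x. x \<in># D \<Longrightarrow> x \<in> P" "\<And>x y. x \<in># D \<Longrightarrow> y \<in># D \<Longrightarrow> R x y" "size D = d"
    using D by (auto simp: multichains_iff)
  obtain j where j: "j \<in># D" "\<And>x. x \<in># D \<Longrightarrow> h x \<le> h j" using max_element[OF D] by blast
  \<comment> \<open>This is where \<open>key D \<le> key C\<close> matters: no vertex of
    \<open>D\<close> is eliminated before \<open>i\<close>.\<close>
  have ji: "h j \<le> h i" using key_le_imp[OF key j(1)] i(2) by (meson order_trans)
  have De: "h x \<le> h i" if "x \<in># D" for x using j(2)[OF that] ji by simp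
  have e'x: "R e' x" if "x \<in># C" for x
    using h_simplicial[of i e' x] that e(2,3) CP DP i De by blast
  have je: "R j e"
  proof (cases "h j = h i")
    case True
    then have "j = i" using inj_h CP(1)[OF i(1)] DP(1)[OF j(1)] by (meson inj_onD)
    then show ?thesis using CP(2) i(1) e(1) by blast
  next
    case False
    then have "h j < h i" using ji by simp
    then show ?thesis
      using h_strong[of i j e' e] CP i(1) e DP j by blast
  qed
  have ex: "R e x" if "x \<in># D" for x
    using h_simplicial[of j e x] that je e DP CP(1) j by (meson less_imp_le order_trans)
  have "add_mset e' X \<in> V" "add_mset e Y \<in> V"
    using CP DP e'x ex R_sym R_refl unfolding multichains_iff X Y by auto
  moreover have "add_mset e' X + add_mset e Y = C + D" by (simp add: X Y)
  moreover have "key C < key (add_mset e' X)" "key (add_mset e Y) < key D"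
    unfolding X Y using e(4) by (auto intro!: key_less simp del: image_mset_add_mset)
  ultimately show thesis using that by blast
qed

text \<open>No exchange applies to any two factors. \<open>C = D\<close> is included: in the square
  of a variable, too, the vertices with great \<open>h\<close> are to be gathered in one
  factor.\<close>

definition normal :: "'a multiset monomial \<Rightarrow> bool" where
  "normal u \<longleftrightarrow> (\<forall>C D c i e e'. u = single C 1 + single D 1 + c \<and> key D \<le> key C \<and>
     i \<in># C \<and> (\<forall>x\<in>#C. h x \<le> h i) \<and> e \<in># C \<and> e' \<in># D \<and> R i e' \<longrightarrow> h e' \<le> h e)"

lemma normalD:
  assumes "normal u" "u = single C 1 + single D 1 + c" "key D \<le> key C"
    "i \<in># C" "\<forall>x\<in>#C. h x \<le> h i" "e \<in># C" "e' \<in># D" "R i e'"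
  shows "h e' \<le> h e"
  using assms unfolding normal_def by metis

text \<open>Of the four multichains \<open>C'\<close> has the greatest key, so its variable is the
  smallest one; it occurs in \<open>t\<close> but not in \<open>s\<close>, and the reverse
  lexicographic order declares \<open>t\<close> smaller.\<close>

lemma not_normal_reducible:
  assumes u: "u \<in> monomials V" and "\<not> normal u"
  shows "\<exists>s t c. u = s + c \<and> s \<in> monomials V \<and> t \<in> monomials V \<and>
    mono_degree s = 2 \<and> multidegree s = multidegree t \<and> s \<noteq> t \<and> (t, s) \<in> degrevlex V key"
proof -
  obtain C D c i e e' where *: "u = single C 1 + single D 1 + c" "key D \<le> key C"
    "i \<in># C" "\<forall>x\<in>#C. h x \<le> h i" "e \<in># C" "e' \<in># D" "R i e'" "h e < h e'"
    using assms(2) unfolding normal_def by (auto simp: not_le)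
  have CD: "C \<in> V" "D \<in> V" using u *(1) by auto
  obtain C' D' where CD': "C' \<in> V" "D' \<in> V" "C' + D' = C + D" "key C < key C'" "key D' < key D"
    using exchange[OF CD *(2,3) _ *(5-8)] *(4) by blast
  let ?s = "single C 1 + single D (1::nat)" and ?t = "single C' 1 + single D' (1::nat)"
  have ne: "C' \<noteq> C" "C' \<noteq> D" "C' \<noteq> D'" using CD' *(2) by auto
  have lk: "lookup ?s C' = 0" "lookup ?t C' = 1" using ne by (auto simp: lookup_add lookup_single)
  have "?s \<noteq> ?t" using lk by auto
  moreover have "lookup ?t v = lookup ?s v" if "key C' < key v" for v
    using that CD' *(2) by (auto simp: lookup_add lookup_single when_def)
  then have "(?t, ?s) \<in> degrevlex V key"
    unfolding degrevlex_def using CD CD' lk by (auto simp: mono_degree_add intro!: bexI[of _ C'])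
  ultimately show ?thesis
    using *(1) CD CD' by (intro exI[of _ ?s] exI[of _ ?t] exI[of _ c]) (simp add: mono_degree_add multidegree_add)
qed

lemma in_multidegree_iff: "x \<in># multidegree u \<longleftrightarrow> (\<exists>D\<in>keys u. x \<in># D)"
proof -
  have "count (multidegree u) x > 0 \<longleftrightarrow> (\<exists>D\<in>keys u. lookup u D * count D x > 0)"
    unfolding count_multidegree[OF finite_keys order_refl]
    by (metis (no_types, lifting) finite_keys gr0I less_numeral_extra(3) sum_eq_0_iff)
  then show ?thesis by (simp add: in_keys_iff)
qed

text \<open>The factor \<open>C\<close> of greatest key contains a vertex \<open>i\<close> of
  greatest \<open>h\<close> in the whole multidegree, as the multiset order looks at the greatest
  values first. Normality against each remaining factor then puts no remaining neighbour of
  \<open>i\<close> above a member of \<open>C\<close>.\<close>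

lemma normal_lead:
  assumes u: "u \<in> monomials V" "normal u" "u \<noteq> 0"
  obtains C u' i where "u = single C 1 + u'" "C \<in> V" "normal u'" "u' \<in> monomials V"
    "i \<in># C" "\<And>x. x \<in># multidegree u \<Longrightarrow> h x \<le> h i"
    "\<And>x y. x \<in># C \<Longrightarrow> y \<in># filter_mset (R i) (multidegree u') \<Longrightarrow> h y \<le> h x"
proof -
  have "key ` keys u \<noteq> {}" using monomial_nonzero_key[OF u(3)] by auto
  then have "Max (key ` keys u) \<in> key ` keys u" by (intro Max_in) auto
  then obtain C where C: "C \<in> keys u" "key C = Max (key ` keys u)" by force
  have max: "key D \<le> key C" if "D \<in> keys u" for D unfolding C(2) using that by simp
  have CV: "C \<in> V" using C(1) u(1) by (auto simp: monomials_def)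
  obtain u' where u': "u = single C 1 + u'" using monomial_split_single[OF C(1)] by blast
  obtain i where i: "i \<in># C" "\<forall>x\<in>#C. h x \<le> h i" using max_element[OF CV] by blast
  have "normal u'"
    unfolding normal_def
  proof (intro allI impI, elim conjE)
    fix A D c k e e'
    assume *: "u' = single A 1 + single D 1 + c" "key D \<le> key A" "k \<in># A" "\<forall>x\<in>#A. h x \<le> h k"
      "e \<in># A" "e' \<in># D" "R k e'"
    have "u = single A 1 + single D 1 + (single C 1 + c)" by (simp add: u' *(1) ac_simps)
    then show "h e' \<le> h e" using *(2-) by (rule normalD[OF u(2)])
  qed
  moreover have "h x \<le> h i" if "x \<in># multidegree u" for x
  proof -
    from that have "\<exists>D\<in>keys u. x \<in># D" by (simp only: in_multidegree_iff)
    then obtain D where D: "D \<in> keys u" "x \<in># D" by (elim bexE)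
    obtain y where "y \<in># C" "h x \<le> h y" using key_le_imp[OF max[OF D(1)] D(2)] by (elim bexE)
    then show ?thesis using i(2) by (meson order_trans)
  qed
  moreover have "h y \<le> h x" if "x \<in># C" "y \<in># filter_mset (R i) (multidegree u')" for x y
  proof -
    from that have "y \<in># multidegree u'" and Ry: "R i y" by simp_all
    then have "\<exists>D\<in>keys u'. y \<in># D" by (simp only: in_multidegree_iff)
    then obtain D where D: "D \<in> keys u'" "y \<in># D" by (elim bexE)
    obtain c where c: "u' = single D 1 + c" using monomial_split_single[OF D(1)] by blast
    have eq: "u = single C 1 + single D 1 + c" by (simp add: u' c ac_simps)
    have "D \<in> keys u" using D(1) by (simp add: u' keys_add_nat)
    then show ?thesis using normalD[OF u(2) eq max i that(1) D(2) Ry] by blast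
  qed
  ultimately show thesis using that u' CV u(1) i(1) by simp
qed

text \<open>Both \<open>i\<close> and the lead factor can be read off the multidegree, and removing
  that factor leaves normal monomials of smaller degree.\<close>

lemma normal_unique:
  assumes "u \<in> monomials V" "normal u" "w \<in> monomials V" "normal w" "multidegree u = multidegree w"
  shows "u = w"
  using assms
proof (induction "mono_degree u" arbitrary: u w)
  case 0
  then show ?case using same_degree[of u w] by simp
next
  case (Suc n)
  have "mono_degree w = Suc n" using same_degree[of u w] Suc by simp
  then have nz: "u \<noteq> 0" "w \<noteq> 0" using Suc.hyps(2) by auto
  obtain C u' i where u: "u = single C 1 + u'" "C \<in> V" "normal u'" "u' \<in> monomials V"
    "i \<in># C" "\<And>x. x \<in># multidegree u \<Longrightarrow> h x \<le> h i"
    "\<And>x y. x \<in># C \<Longrightarrow> y \<in># filter_mset (R i) (multidegree u') \<Longrightarrow> h y \<le> h x"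
    using normal_lead[OF Suc.prems(1,2) nz(1)] by metis
  obtain D w' j where w: "w = single D 1 + w'" "D \<in> V" "normal w'" "w' \<in> monomials V"
    "j \<in># D" "\<And>x. x \<in># multidegree w \<Longrightarrow> h x \<le> h j"
    "\<And>x y. x \<in># D \<Longrightarrow> y \<in># filter_mset (R j) (multidegree w') \<Longrightarrow> h y \<le> h x"
    using normal_lead[OF Suc.prems(3,4) nz(2)] by metis
  have md: "multidegree u = C + multidegree u'" "multidegree w = D + multidegree w'"
    using u(1) w(1) by (simp_all add: multidegree_add)
  have eq: "C + multidegree u' = D + multidegree w'" using md Suc.prems(5) by simp
  have P: "x \<in> P" if "x \<in># multidegree u" for x
    using that Suc.prems(1) by (auto simp: in_multidegree_iff monomials_def multichains_iff subset_iff)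
  have "i \<in># multidegree u" using md(1) u(5) by simp
  moreover have "j \<in># multidegree w" using md(2) w(5) by simp
  ultimately have ij: "i = j" using u(6)[of j] w(6)[of i] Suc.prems(5) P inj_h by (metis inj_onD order_antisym)
  \<comment> \<open>Members of \<open>C\<close> and \<open>D\<close> are comparable with
    \<open>i\<close>, so filtering the common multidegree by \<open>R i\<close> retains both
    completely.\<close>
  have full: "filter_mset (R i) C = C" "filter_mset (R i) D = D"
    using u(2,5) w(2,5) ij by (auto simp: filter_mset_eq_conv multichains_iff)
  have "C = D"
  proof (rule top_submultiset_unique)
    show "C + filter_mset (R i) (multidegree u') = D + filter_mset (R i) (multidegree w')"
      using arg_cong[OF eq, of "filter_mset (R i)"] full by simp
    show "size C = size D" using u(2) w(2) by (simp add: multichains_iff)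
    show "inj_on h (set_mset (C + filter_mset (R i) (multidegree u')))"
      using inj_h by (rule inj_on_subset) (use P md in auto)
  qed (use u(7) w(7) ij in auto)
  moreover have "u' = w'"
  proof (rule Suc.hyps(1))
    show "n = mono_degree u'" using Suc.hyps(2) u(1) by (simp add: mono_degree_add)
    show "multidegree u' = multidegree w'" using eq \<open>C = D\<close> by simp
  qed (use u w in auto)
  ultimately show ?case using u(1) w(1) by simp
qed

text \<open>The least monomial of a fibre is normal, since a reduction would produce a smaller one,
  and by uniqueness it is the only normal one. A monomial with a smaller companion in its fibre is
  therefore reducible.\<close>

lemma quadratic_groebner:
  "has_quadratic_groebner_basis V (toric_ideal P V rho :: ('a multiset, 'k::field) mpoly set)"
proof (rule groebner_criterion)
  let ?r = "degrevlex V key"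
  show r: "monomial_order V ?r"
    using monomial_order_degrevlex fin_V inj_on_image_mset_multichains inj_h by blast
  fix u w assume uw: "u \<in> monomials V" "w \<in> monomials V" "multidegree u = multidegree w"
    "u \<noteq> w" "(w, u) \<in> ?r"
  show "\<exists>s t c. u = s + c \<and> s \<in> monomials V \<and> t \<in> monomials V \<and>
    mono_degree s = 2 \<and> multidegree s = multidegree t \<and> s \<noteq> t \<and> (t, s) \<in> ?r"
  proof (rule ccontr)
    assume "\<not> ?thesis"
    then have nu: "normal u" using not_normal_reducible[OF uw(1)] by blast
    define F where "F = {v \<in> monomials V. multidegree v = multidegree u}"
    have "F \<subseteq> {v \<in> monomials V. mono_degree v = mono_degree u}"
      using same_degree[OF _ uw(1)] by (auto simp: F_def)
    then have finF: "finite F" using finite_monomials_degree[OF fin_V] finite_subset by blast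
    obtain v where v: "v \<in> F" "\<And>x. x \<in> F \<Longrightarrow> (v, x) \<in> ?r"
      using monomial_order_min[OF r finF] uw(1) by (auto simp: F_def)
    have "normal v"
    proof (rule ccontr)
      assume "\<not> normal v"
      then obtain s t c where st: "v = s + c" "s \<in> monomials V" "t \<in> monomials V"
        "multidegree s = multidegree t" "s \<noteq> t" "(t, s) \<in> ?r"
        using not_normal_reducible[of v] v(1) by (auto simp: F_def)
      have "t + c \<in> F" "c \<in> monomials V" using v(1) st by (auto simp: F_def multidegree_add)
      then have "(v, t + c) \<in> ?r" "(t + c, v) \<in> ?r"
        using v(2) st monomial_order_add[OF r st(3,2) _ st(6)] by auto
      then have "v = t + c" using monomial_order_antisym[OF r] by blast
      then show False using st by simp
    qed
    then have "v = u" using normal_unique[of v u] v(1) nu uw(1) by (auto simp: F_def)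
    then have "(u, w) \<in> ?r" using v(2)[of w] uw by (simp add: F_def)
    then show False using monomial_order_antisym[OF r] uw(4,5) by blast
  qed
qed

end

theorem theorem1p2:
  fixes P :: "'a::order set"
  assumes "finite P"
  defines "I \<equiv> (\<lambda>d. multichain_ideal d P :: ('a multiset, 'k::field) mpoly set)"
  defines "c1 \<equiv> chordal P (comparability_edges P)"
    and "c2 \<equiv> (\<exists>d\<ge>2. generated_by_quadratic_binomials (multichains d P) (I d))"
    and "c3 \<equiv> (\<exists>d\<ge>2. has_quadratic_groebner_basis (multichains d P) (I d))"
    and "c4 \<equiv> (\<forall>d\<ge>2. generated_by_quadratic_binomials (multichains d P) (I d))"
    and "c5 \<equiv> (\<forall>d\<ge>2. has_quadratic_groebner_basis (multichains d P) (I d))"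
  shows "(c1 \<longleftrightarrow> c2) \<and> (c1 \<longleftrightarrow> c3) \<and> (c1 \<longleftrightarrow> c4) \<and> (c1 \<longleftrightarrow> c5)"
proof -
  have config: "multiset_configuration P (multichains d P) d" if "d \<ge> 2" for d
    using multiset_configuration_multichains[OF \<open>finite P\<close>] that by simp
  have I: "I d = toric_ideal P (multichains d P) rho" for d
    by (simp add: I_def multichain_ideal_def)
  have generated: c1 if "d \<ge> 2" "generated_by_quadratic_binomials (multichains d P) (I d)" for d
    using multiset_configuration.generated_imp_connected[OF config[OF that(1)] that(2)[unfolded I]]
      not_chordal_imp_not_connected[OF \<open>finite P\<close> that(1)] unfolding c1_def by blast
  have groebner: c1 if "d \<ge> 2" "has_quadratic_groebner_basis (multichains d P) (I d)" for d
    using multiset_configuration.groebner_imp_connected[OF config[OF that(1)] that(2)[unfolded I]]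
      not_chordal_imp_not_connected[OF \<open>finite P\<close> that(1)] unfolding c1_def by blast
  have "has_quadratic_groebner_basis (multichains d P) (I d) \<and>
      generated_by_quadratic_binomials (multichains d P) (I d)" if c1 "d \<ge> 2" for d
  proof -
    obtain h where h: "strong_elimination (comparable (\<le>)) P h"
      using chordal_strong_elimination[OF \<open>finite P\<close>] \<open>c1\<close> unfolding c1_def by blast
    have "eliminable_poset P h d" using \<open>finite P\<close> \<open>d \<ge> 2\<close> h by unfold_locales auto
    then have gb: "has_quadratic_groebner_basis (multichains d P) (I d)"
      unfolding I by (rule eliminable_poset.quadratic_groebner)
    \<comment> \<open>Generation by quadratic binomials is reached through connectivity: descent
      along the Groebner basis links each fibre, and the links generate.\<close>
    then have "multiset_configuration.fibers_connected (multichains d P)"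
      unfolding I by (rule multiset_configuration.groebner_imp_connected[OF config[OF \<open>d \<ge> 2\<close>]])
    then show ?thesis
      using gb multiset_configuration.connected_imp_generated[OF config[OF \<open>d \<ge> 2\<close>]] unfolding I by blast
  qed
  \<comment> \<open>The value \<open>d = 2\<close> leads from the statements for all
    \<open>d\<close> to those for some \<open>d\<close>.\<close>
  then show ?thesis
    using generated groebner unfolding c2_def c3_def c4_def c5_def by (meson order_refl)
qed

end
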